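(* There exist compact $8$-manifolds with a harmonic $PSU(3)$-structure with non-vanishing intrinsic torsion, and compact $8$-manifolds with a harmonic $Sp(1)\cdot Sp(2)$-structure with non-vanishing intrinsic torsion. Further, such structures are not necessarily Einstein: for each of the two groups there is such a compact example whose induced metric is not an Einstein metric.
   Context: $PSU(3)=SU(3)/\mathbb Z_3\subset SO(8)$ is embedded by the adjoint representation on $\mathfrak{su}(3)\cong\mathbb R^8$. A topological $PSU(3)$-structure on $M^8$ is a reduction of the frame bundle to $PSU(3)$; equivalently, an orientation and a $3$-form $\rho$ which in suitable positively oriented local coframes equals $$\tfrac12 e_{123}+\tfrac14e_1\wedge(e_{47}-e_{56})+\tfrac14e_2\wedge(e_{46}+e_{57})+\tfrac14e_3\wedge(e_{45}-e_{67})+\tfrac{\sqrt3}{4}e_8\wedge(e_{45}+e_{67}).$$ $Sp(1)\cdot Sp(2)=(Sp(1)\times Sp(2))/\mathbb Z_2\subset SO(8)$ acts in the standard way on $\mathbb R^8=\mathbb H^2$. A topological $Sp(1)\cdot Sp(2)$-structure is a reduction of the frame bundle to this group; equivalently, a $4$-form $\Omega$ which in suitable local coframes satisfies $$\tfrac12\Omega=-3e_{1234}+e_{1256}-e_{1278}+e_{1357}+e_{1368}+e_{1458}-e_{1467}-e_{2358}+e_{2367}+e_{2457}+e_{2468}-e_{3456}+e_{3478}-3e_{5678}.$$ In both cases the induced metric $g$ makes these frames orthonormal. The structure is called harmonic if its defining form $\gamma$ ($\gamma=\rho$, respectively $\gamma=\Omega$) is closed and coclosed with respect to $g$. The intrinsic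 torsion is the section $T$ of $T^*M\otimes\mathfrak g^\perp$ ($\mathfrak g$ the Lie algebra of the structure group, $\mathfrak g^\perp$ its orthogonal complement in $\Lambda^2\cong\mathfrak{so}(8)$) with $\nabla\gamma=T(\gamma)$, $\nabla$ the Levi-Civita connection of $g$; thus $T$ is non-vanishing (not identically zero) iff $\nabla\gamma\not\equiv0$. *)

theory Defs
  imports "HOL-Analysis.Analysis"
begin

text \<open>\<open>C\<^sup>k\<close> functions on \<open>S\<close>; only meaningful for open \<open>S\<close>.\<close>

primrec Ck_on :: "nat \<Rightarrow> 'a::real_normed_vector set \<Rightarrow> ('a \<Rightarrow> 'b::real_normed_vector) \<Rightarrow> bool" where
  "Ck_on 0 S f \<longleftrightarrow> continuous_on S f"
| "Ck_on (Suc k) S f \<longleftrightarrow>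
     (\<forall>x\<in>S. f differentiable (at x)) \<and> (\<forall>v. Ck_on k S (\<lambda>x. frechet_derivative f (at x) v))"

definition smooth_on :: "'a::real_normed_vector set \<Rightarrow> ('a \<Rightarrow> 'b::real_normed_vector) \<Rightarrow> bool" where
  "smooth_on S f \<longleftrightarrow> (\<forall>k. Ck_on k S f)"


section \<open>Manifolds of dimension 8\<close>

type_synonym 'a chart = "'a set \<times> ('a \<Rightarrow> real^8)"

definition chart_im :: "'a chart \<Rightarrow> (real^8) set" where
  "chart_im c = snd c ` fst c"

definition transition :: "'a chart \<Rightarrow> 'a chart \<Rightarrow> real^8 \<Rightarrow> real^8" where
  "transition c c' = snd c' \<circ> inv_into (fst c) (snd c)"

text \<open>The atlas \<open>A\<close> is not assumed to be maximal. Manifolds are taken to be connected, as usual.\<close>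

definition manifold8 :: "'a topology \<Rightarrow> 'a chart set \<Rightarrow> bool" where
  "manifold8 X A \<longleftrightarrow>
     Hausdorff_space X \<and> connected_space X \<and>
     (\<exists>\<B>. countable \<B> \<and> (\<forall>V\<in>\<B>. openin X V) \<and>
          (\<forall>U p. openin X U \<and> p \<in> U \<longrightarrow> (\<exists>V\<in>\<B>. p \<in> V \<and> V \<subseteq> U))) \<and>
     \<Union> (fst ` A) = topspace X \<and>
     (\<forall>c\<in>A. openin X (fst c) \<and> open (chart_im c) \<and>
        homeomorphic_map (subtopology X (fst c)) (top_of_set (chart_im c)) (snd c)) \<and>
     (\<forall>c\<in>A. \<forall>c'\<in>A. smooth_on (snd c ` (fst c \<inter> fst c')) (transition c c'))"

text \<open>An orientation is given by an atlas all of whose charts are positively oriented.\<close>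

definition oriented_atlas :: "'a chart set \<Rightarrow> bool" where
  "oriented_atlas A \<longleftrightarrow>
     (\<forall>c\<in>A. \<forall>c'\<in>A. \<forall>x\<in>snd c ` (fst c \<inter> fst c').
        det (matrix (frechet_derivative (transition c c') (at x))) > 0)"


section \<open>Covariant tensors\<close>

text \<open>
  A covariant tensor of rank \<open>k\<close> on \<open>\<real>\<^sup>8\<close> is a function of which only the values on
  lists of \<open>k\<close> vectors matter. A tensor field on a manifold is the family of its
  local representatives in the charts.
\<close>

type_synonym tensor = "(real^8) list \<Rightarrow> real"
type_synonym local_field = "real^8 \<Rightarrow> tensor"

definition multilinear_on :: "nat \<Rightarrow> tensor \<Rightarrow> bool" where
  "multilinear_on k t \<longleftrightarrow>
     (\<forall>us ws. length us + 1 + length ws = k \<longrightarrow> linear (\<lambda>v. t (us @ v # ws)))"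

definition alternating_on :: "nat \<Rightarrow> tensor \<Rightarrow> bool" where
  "alternating_on k t \<longleftrightarrow> (\<forall>vs. length vs = k \<and> \<not> distinct vs \<longrightarrow> t vs = 0)"

definition alt_forms :: "nat \<Rightarrow> tensor set" where
  "alt_forms k = {t. multilinear_on k t \<and> alternating_on k t}"

definition tensor_field :: "'a chart set \<Rightarrow> nat \<Rightarrow> ('a chart \<Rightarrow> local_field) \<Rightarrow> bool" where
  "tensor_field A k T \<longleftrightarrow>
     (\<forall>c\<in>A. (\<forall>x\<in>chart_im c. multilinear_on k (T c x)) \<and>
             (\<forall>vs. length vs = k \<longrightarrow> smooth_on (chart_im c) (\<lambda>x. T c x vs))) \<and>
     (\<forall>c\<in>A. \<forall>c'\<in>A. \<forall>p\<in>fst c \<inter> fst c'. \<forall>vs. length vs = k \<longrightarrow>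
        T c (snd c p) vs =
        T c' (snd c' p) (map (frechet_derivative (transition c c') (at (snd c p))) vs))"

definition diff_form :: "'a chart set \<Rightarrow> nat \<Rightarrow> ('a chart \<Rightarrow> local_field) \<Rightarrow> bool" where
  "diff_form A k \<omega> \<longleftrightarrow>
     tensor_field A k \<omega> \<and> (\<forall>c\<in>A. \<forall>x\<in>chart_im c. \<omega> c x \<in> alt_forms k)"

definition riemannian_metric :: "'a chart set \<Rightarrow> ('a chart \<Rightarrow> local_field) \<Rightarrow> bool" where
  "riemannian_metric A g \<longleftrightarrow>
     tensor_field A 2 g \<and>
     (\<forall>c\<in>A. \<forall>x\<in>chart_im c.
        (\<forall>u v. g c x [u, v] = g c x [v, u]) \<and> (\<forall>v. v \<noteq> 0 \<longrightarrow> g c x [v, v] > 0))"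


section \<open>Exterior derivative and Hodge star\<close>

definition omit :: "nat \<Rightarrow> 'b list \<Rightarrow> 'b list" where
  "omit i vs = take i vs @ drop (Suc i) vs"

text \<open>Cartan's formula for constant vector fields in a chart.\<close>

definition ext_deriv :: "local_field \<Rightarrow> local_field" where
  "ext_deriv \<omega> x vs =
     (\<Sum>i<length vs. (-1)^i * frechet_derivative (\<lambda>y. \<omega> y (omit i vs)) (at x) (vs ! i))"

text \<open>The vector dual to the covector \<open>\<alpha>\<close> with respect to the inner product \<open>h\<close>.\<close>

definition sharp :: "tensor \<Rightarrow> (real^8 \<Rightarrow> real) \<Rightarrow> real^8" where
  "sharp h \<alpha> = (THE z. \<forall>w. h [z, w] = \<alpha> w)"

abbreviation basis_vec :: "8 \<Rightarrow> real^8" where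
  "basis_vec i \<equiv> axis i 1"

text \<open>
  With \<open>h\<^sub>i\<^sub>j\<close> the coefficients of \<open>h\<close>, \<open>raised_vec h i\<close> is the vector \<open>\<Sum>\<^sub>j h\<^sup>i\<^sup>j \<partial>\<^sub>j\<close>;
  evaluating a form on such vectors raises its indices.
\<close>

definition raised_vec :: "tensor \<Rightarrow> 8 \<Rightarrow> real^8" where
  "raised_vec h i = sharp h (\<lambda>w. w $ i)"

definition vol_form :: "tensor \<Rightarrow> tensor" where
  "vol_form h vs =
     sqrt (det (\<chi> i j. h [basis_vec i, basis_vec j])) * det (vector vs :: real^8^8)"

text \<open>
  \<open>(*\<omega>)\<^sub>J = 1/k! \<Sum>\<^sub>I \<omega>\<^sup>I vol\<^sub>I\<^sub>J\<close> for a \<open>k\<close>-form \<open>\<omega>\<close>, with respect to the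
  orientation of the chart; a change of orientation only changes the sign.
\<close>

definition hodge_star :: "nat \<Rightarrow> tensor \<Rightarrow> tensor \<Rightarrow> tensor" where
  "hodge_star k h \<omega> ws =
     (\<Sum>I\<in>{I :: 8 list. length I = k}.
        \<omega> (map (raised_vec h) I) * vol_form h (map basis_vec I @ ws)) / fact k"

definition closed_form :: "'a chart set \<Rightarrow> nat \<Rightarrow> ('a chart \<Rightarrow> local_field) \<Rightarrow> bool" where
  "closed_form A k \<omega> \<longleftrightarrow>
     (\<forall>c\<in>A. \<forall>x\<in>chart_im c. \<forall>vs. length vs = Suc k \<longrightarrow> ext_deriv (\<omega> c) x vs = 0)"

definition coclosed_form ::
    "'a chart set \<Rightarrow> ('a chart \<Rightarrow> local_field) \<Rightarrow> nat \<Rightarrow> ('a chart \<Rightarrow> local_field) \<Rightarrow> bool" where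
  "coclosed_form A g k \<omega> \<longleftrightarrow> closed_form A (8 - k) (\<lambda>c x. hodge_star k (g c x) (\<omega> c x))"

definition harmonic ::
    "'a chart set \<Rightarrow> ('a chart \<Rightarrow> local_field) \<Rightarrow> nat \<Rightarrow> ('a chart \<Rightarrow> local_field) \<Rightarrow> bool" where
  "harmonic A g k \<gamma> \<longleftrightarrow> closed_form A k \<gamma> \<and> coclosed_form A g k \<gamma>"


section \<open>Levi-Civita connection and Ricci curvature\<close>

text \<open>
  \<open>christoffel h x u v\<close> is \<open>\<nabla>\<^sub>u v\<close> at \<open>x\<close> for constant vector fields \<open>u\<close>, \<open>v\<close> in a chart,
  as given by Koszul's formula.
\<close>

definition christoffel :: "local_field \<Rightarrow> real^8 \<Rightarrow> real^8 \<Rightarrow> real^8 \<Rightarrow> real^8" where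
  "christoffel h x u v = sharp (h x) (\<lambda>w.
     (frechet_derivative (\<lambda>y. h y [v, w]) (at x) u
      + frechet_derivative (\<lambda>y. h y [u, w]) (at x) v
      - frechet_derivative (\<lambda>y. h y [u, v]) (at x) w) / 2)"

definition cov_deriv :: "local_field \<Rightarrow> local_field \<Rightarrow> real^8 \<Rightarrow> real^8 \<Rightarrow> tensor" where
  "cov_deriv h t x u vs =
     frechet_derivative (\<lambda>y. t y vs) (at x) u
     - (\<Sum>i<length vs. t x (vs[i := christoffel h x u (vs ! i)]))"

definition riemann :: "local_field \<Rightarrow> real^8 \<Rightarrow> real^8 \<Rightarrow> real^8 \<Rightarrow> real^8 \<Rightarrow> real^8" where
  "riemann h x u v w =
     frechet_derivative (\<lambda>y. christoffel h y v w) (at x) u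
     - frechet_derivative (\<lambda>y. christoffel h y u w) (at x) v
     + christoffel h x u (christoffel h x v w)
     - christoffel h x v (christoffel h x u w)"

definition ricci :: "local_field \<Rightarrow> real^8 \<Rightarrow> real^8 \<Rightarrow> real^8 \<Rightarrow> real" where
  "ricci h x v w = (\<Sum>i\<in>UNIV. riemann h x (basis_vec i) v w $ i)"

definition einstein :: "'a chart set \<Rightarrow> ('a chart \<Rightarrow> local_field) \<Rightarrow> bool" where
  "einstein A g \<longleftrightarrow>
     (\<exists>\<kappa>. \<forall>c\<in>A. \<forall>x\<in>chart_im c. \<forall>v w. ricci (g c) x v w = \<kappa> * g c x [v, w])"


section \<open>Intrinsic torsion\<close>

text \<open>
  A 2-form \<open>a\<close> is identified with the skew endomorphism \<open>A\<close> such that \<open>h(Au, v) = a(u, v)\<close>,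
  which acts on covariant tensors as a derivation.
\<close>

definition act :: "tensor \<Rightarrow> tensor \<Rightarrow> tensor \<Rightarrow> tensor" where
  "act h a t vs = - (\<Sum>i<length vs. t (vs[i := sharp h (\<lambda>w. a [vs ! i, w])]))"

text \<open>
  The Lie algebra of the stabilizer of \<open>t\<close> in the special orthogonal group of \<open>h\<close>.
\<close>

definition stab_algebra :: "tensor \<Rightarrow> nat \<Rightarrow> tensor \<Rightarrow> tensor set" where
  "stab_algebra h k t = {a \<in> alt_forms 2. \<forall>vs. length vs = k \<longrightarrow> act h a t vs = 0}"

definition inner_2form :: "tensor \<Rightarrow> tensor \<Rightarrow> tensor \<Rightarrow> real" where
  "inner_2form h a b =
     (\<Sum>i\<in>UNIV. \<Sum>j\<in>UNIV. a [raised_vec h i, raised_vec h j] * b [basis_vec i, basis_vec j]) / 2"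

definition stab_perp :: "tensor \<Rightarrow> nat \<Rightarrow> tensor \<Rightarrow> tensor set" where
  "stab_perp h k t = {a \<in> alt_forms 2. \<forall>b\<in>stab_algebra h k t. inner_2form h a b = 0}"

definition intrinsic_torsion ::
    "'a chart set \<Rightarrow> ('a chart \<Rightarrow> local_field) \<Rightarrow> nat \<Rightarrow> ('a chart \<Rightarrow> local_field) \<Rightarrow>
     ('a chart \<Rightarrow> local_field) \<Rightarrow> bool" where
  "intrinsic_torsion A g k \<gamma> T \<longleftrightarrow>
     tensor_field A 3 T \<and>
     (\<forall>c\<in>A. \<forall>x\<in>chart_im c. \<forall>u.
        (\<lambda>vs. T c x (u # vs)) \<in> stab_perp (g c x) k (\<gamma> c x) \<and>
        (\<forall>vs. length vs = k \<longrightarrow>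
           cov_deriv (g c) (\<gamma> c) x u vs = act (g c x) (\<lambda>vs. T c x (u # vs)) (\<gamma> c x) vs))"

definition nonvanishing_torsion ::
    "'a chart set \<Rightarrow> ('a chart \<Rightarrow> local_field) \<Rightarrow> nat \<Rightarrow> ('a chart \<Rightarrow> local_field) \<Rightarrow> bool" where
  "nonvanishing_torsion A g k \<gamma> \<longleftrightarrow>
     (\<exists>T. intrinsic_torsion A g k \<gamma> T \<and>
        (\<exists>c\<in>A. \<exists>x\<in>chart_im c. \<exists>vs. length vs = 3 \<and> T c x vs \<noteq> 0))"


section \<open>The two structure groups\<close>

text \<open>
  \<open>ecov [i\<^sub>1, \<dots>, i\<^sub>k]\<close> is the wedge product of the coordinate covectors, expanded along the
  first factor with the same convention as in \<open>ext_deriv\<close>. In the index type, \<open>8 = 0\<close>.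
\<close>

fun ecov :: "8 list \<Rightarrow> tensor" where
  "ecov [] vs = 1"
| "ecov (i # I) vs = (\<Sum>j<length vs. (-1)^j * (vs ! j $ i) * ecov I (omit j vs))"

definition rho0 :: tensor where
  "rho0 vs =
     1/2 * ecov [1,2,3] vs
     + 1/4 * (ecov [1,4,7] vs - ecov [1,5,6] vs)
     + 1/4 * (ecov [2,4,6] vs + ecov [2,5,7] vs)
     + 1/4 * (ecov [3,4,5] vs - ecov [3,6,7] vs)
     + sqrt 3 / 4 * (ecov [8,4,5] vs + ecov [8,6,7] vs)"

definition Omega0 :: tensor where
  "Omega0 vs = 2 *
     (- 3 * ecov [1,2,3,4] vs + ecov [1,2,5,6] vs - ecov [1,2,7,8] vs + ecov [1,3,5,7] vs
      + ecov [1,3,6,8] vs + ecov [1,4,5,8] vs - ecov [1,4,6,7] vs - ecov [2,3,5,8] vs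
      + ecov [2,3,6,7] vs + ecov [2,4,5,7] vs + ecov [2,4,6,8] vs - ecov [3,4,5,6] vs
      + ecov [3,4,7,8] vs - 3 * ecov [5,6,7,8] vs)"

text \<open>
  A local coframe on \<open>W\<close> is a field \<open>E\<close> of invertible matrices with the covectors as rows. It
  is adapted if it brings \<open>\<gamma>\<close> into the normal form \<open>\<gamma>\<^sub>0\<close> and is orthonormal for \<open>g\<close>.
  The stabilizers of \<open>rho0\<close> (among matrices of positive determinant) and of \<open>Omega0\<close>
  preserve the Euclidean inner product, so one adapted coframe at each point determines \<open>g\<close>
  from \<open>\<gamma>\<close>: it is the induced metric.
\<close>

definition adapted_coframe ::
    "nat \<Rightarrow> tensor \<Rightarrow> local_field \<Rightarrow> local_field \<Rightarrow> (real^8) set \<Rightarrow> (real^8 \<Rightarrow> real^8^8) \<Rightarrow> bool" where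
  "adapted_coframe k \<gamma>\<^sub>0 \<gamma> g W E \<longleftrightarrow>
     smooth_on W E \<and>
     (\<forall>y\<in>W. invertible (E y) \<and>
        (\<forall>vs. length vs = k \<longrightarrow> \<gamma> y vs = \<gamma>\<^sub>0 (map ((*v) (E y)) vs)) \<and>
        (\<forall>u v. g y [u, v] = (E y *v u) \<bullet> (E y *v v)))"

definition PSU3_structure ::
    "'a chart set \<Rightarrow> ('a chart \<Rightarrow> local_field) \<Rightarrow> ('a chart \<Rightarrow> local_field) \<Rightarrow> bool" where
  "PSU3_structure A \<rho> g \<longleftrightarrow>
     oriented_atlas A \<and> diff_form A 3 \<rho> \<and> riemannian_metric A g \<and>
     (\<forall>c\<in>A. \<forall>x\<in>chart_im c. \<exists>W E. open W \<and> x \<in> W \<and> W \<subseteq> chart_im c \<and>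
        adapted_coframe 3 rho0 (\<rho> c) (g c) W E \<and> (\<forall>y\<in>W. det (E y) > 0))"

definition Sp1Sp2_structure ::
    "'a chart set \<Rightarrow> ('a chart \<Rightarrow> local_field) \<Rightarrow> ('a chart \<Rightarrow> local_field) \<Rightarrow> bool" where
  "Sp1Sp2_structure A \<Omega> g \<longleftrightarrow>
     diff_form A 4 \<Omega> \<and> riemannian_metric A g \<and>
     (\<forall>c\<in>A. \<forall>x\<in>chart_im c. \<exists>W E. open W \<and> x \<in> W \<and> W \<subseteq> chart_im c \<and>
        adapted_coframe 4 Omega0 (\<Omega> c) (g c) W E)"

definition harmonic_PSU3_structure ::
    "'a chart set \<Rightarrow> ('a chart \<Rightarrow> local_field) \<Rightarrow> ('a chart \<Rightarrow> local_field) \<Rightarrow> bool" where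
  "harmonic_PSU3_structure A \<rho> g \<longleftrightarrow> PSU3_structure A \<rho> g \<and> harmonic A g 3 \<rho>"

definition harmonic_Sp1Sp2_structure ::
    "'a chart set \<Rightarrow> ('a chart \<Rightarrow> local_field) \<Rightarrow> ('a chart \<Rightarrow> local_field) \<Rightarrow> bool" where
  "harmonic_Sp1Sp2_structure A \<Omega> g \<longleftrightarrow> Sp1Sp2_structure A \<Omega> g \<and> harmonic A g 4 \<Omega>"

text \<open>
  Existence of a manifold cannot be stated over all types of points. Every manifold has at most
  the cardinality of the continuum, so the following fixed type is no restriction;
  quotients of \<open>\<real>\<^sup>8\<close> live on it directly.
\<close>

type_synonym point = "(real^8) set"

end

theory Submission
  imports Defs
begin

text \<open>
  Both examples are 2-step nilmanifolds with left-invariant structures. On \<open>\<real>\<^sup>8\<close> with a coframe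
  satisfying \<open>de\<^sup>i = \<Sum> a\<^sup>i\<^sub>p\<^sub>q e\<^sup>p\<^sup>q\<close> with constant coefficients, closedness and coclosedness of a form with constant
  coefficients in the coframe, its covariant derivative and the Ricci tensor all become algebraic.
  For \<open>PSU(3)\<close> take \<open>de\<^sup>8 = e\<^sup>4\<^sup>7 + e\<^sup>5\<^sup>6\<close> and the other \<open>e\<^sup>i\<close> closed.
  For \<open>Sp(1)\<cdot>Sp(2)\<close> write \<open>\<Omega> = e\<^sup>1 \<and> \<alpha> + \<beta>\<close> and let \<open>de\<^sup>i = e\<^sup>1 \<and> N e\<^sup>i\<close>, where \<open>N\<close> acts on the span
  of \<open>e\<^sup>2, \<dots>, e\<^sup>8\<close>: then \<open>d\<Omega> = 0\<close> iff \<open>N\<close> annihilates \<open>\<beta>\<close>. The form \<open>\<beta>\<close> is stable, and its stabilizer is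
  a copy of split \<open>g\<^sub>2\<close> not contained in \<open>so(7)\<close>; choose \<open>N\<close> nilpotent in it with \<open>N\<^sup>2 = 0\<close>. As \<open>\<Omega>\<close> is
  self-dual, it is coclosed as well. Since \<open>Ric\<close> vanishes in one direction but not
  in another, neither metric is Einstein.
\<close>

section \<open>Exterior algebra on lists of vectors\<close>

text \<open>Two-step nilpotency keeps the analysis elementary: since
  \<open>b (b u v) w = b u (b v w) = 0\<close>, the invariant coframe and the lattice translations
  are affine in the point, and the derivative of an invariant field is a sum of the same field at
  other arguments. For PSU(3), in the span of e4, ..., e7 the factor of e8 in rho is the self-dual
  form e45 + e67, while the factors of e1, e2, e3 are anti-self-dual. The form e47 + e56 is
  self-dual and orthogonal to e45 + e67, so its wedge product with each of these four forms
  vanishes; this yields closedness and coclosedness. For Sp(1)Sp(2) the obstacle is the lattice: N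
  has entries with sqrt 3 in an adapted coframe. A linear map P makes the structure constants
  integral in lattice coordinates and leaves the coframe adapted. The stabilizer algebras are never
  computed. The torsion comes from orthogonal projection onto the complement of the stabilizer
  algebra, whatever that is, and one nonzero coefficient of the covariant derivative shows that it
  does not vanish.\<close>

lemma univ_8: "(UNIV :: 8 set) = {1,2,3,4,5,6,7,8}"
proof -
  have "x \<in> {1,2,3,4,5,6,7,8}" for x :: 8
  proof (cases x)
    case (of_int z)
    then have "z = 0 \<or> z = 1 \<or> z = 2 \<or> z = 3 \<or> z = 4 \<or> z = 5 \<or> z = 6 \<or> z = 7"
      by auto
    with of_int show ?thesis by auto
  qed
  then show ?thesis by blast
qed

text \<open>
  \<open>asum f [v\<^sub>0, \<dots>, v\<^sub>n] = \<Sum>\<^sub>i (-1)\<^sup>i f v\<^sub>i [v\<^sub>0, \<dots>, v\<^sub>n without v\<^sub>i]\<close> is the common shape of \<open>ecov\<close> and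
  \<open>ext_deriv\<close>; the recursion over the list avoids all index arithmetic. Likewise \<open>dersum A t\<close> is
  the derivation \<open>\<Sum>\<^sub>i t(\<dots>, A v\<^sub>i, \<dots>)\<close>.
\<close>

primrec asum :: "('b \<Rightarrow> 'b list \<Rightarrow> real) \<Rightarrow> 'b list \<Rightarrow> real" where
  "asum f [] = 0"
| "asum f (v # vs) = f v vs - asum (\<lambda>w ws. f w (v # ws)) vs"

primrec dersum :: "('b \<Rightarrow> 'b) \<Rightarrow> ('b list \<Rightarrow> real) \<Rightarrow> 'b list \<Rightarrow> real" where
  "dersum A t [] = 0"
| "dersum A t (v # vs) = t (A v # vs) + dersum A (\<lambda>us. t (v # us)) vs"

lemma asum_conv_sum:
  "asum f vs = (\<Sum>i<length vs. (-1)^i * f (vs ! i) (omit i vs))"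
  by (induction vs arbitrary: f)
     (simp_all add: omit_def sum.lessThan_Suc_shift sum_negf del: sum.lessThan_Suc)

lemma dersum_conv_sum:
  "dersum A t vs = (\<Sum>i<length vs. t (vs[i := A (vs ! i)]))"
  by (induction vs arbitrary: t) (simp_all add: sum.lessThan_Suc_shift del: sum.lessThan_Suc)

lemma ecov_Cons: "ecov (i # I) vs = asum (\<lambda>v us. v $ i * ecov I us) vs"
  by (simp add: asum_conv_sum mult.assoc)

lemma asum_add: "asum (\<lambda>v us. f v us + g v us) vs = asum f vs + asum g vs"
  by (induction vs arbitrary: f g) simp_all

lemma asum_diff: "asum (\<lambda>v us. f v us - g v us) vs = asum f vs - asum g vs"
  by (induction vs arbitrary: f g) simp_all

lemma asum_scale: "asum (\<lambda>v us. a * f v us) vs = a * asum f vs"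
  by (induction vs arbitrary: f) (simp_all add: right_diff_distrib)

lemma asum_zero: "asum (\<lambda>v us. 0) vs = 0"
  by (induction vs) simp_all

text \<open>
  The source of every sign rule: of \<open>d(e\<^sup>i \<and> \<eta>) = de\<^sup>i \<and> \<eta> - e\<^sup>i \<and> d\<eta>\<close> as well as of
  \<open>e\<^sup>i \<and> e\<^sup>j = - e\<^sup>j \<and> e\<^sup>i\<close>.
\<close>

lemma asum_swap:
  "asum (\<lambda>v ws. asum (\<lambda>w us. f v w us) ws) vs = - asum (\<lambda>v ws. asum (\<lambda>w us. f w v us) ws) vs"
proof (induction vs arbitrary: f)
  case (Cons v vs)
  show ?case
    using Cons.IH[of "\<lambda>w x us. f w x (v # us)"] by (simp add: asum_diff)
qed simp

lemma dersum_add: "dersum A (\<lambda>us. s us + t us) vs = dersum A s vs + dersum A t vs"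
  by (induction vs arbitrary: s t) simp_all

lemma dersum_diff: "dersum A (\<lambda>us. s us - t us) vs = dersum A s vs - dersum A t vs"
  by (induction vs arbitrary: s t) simp_all

lemma dersum_scale: "dersum A (\<lambda>us. a * t us) vs = a * dersum A t vs"
  by (induction vs arbitrary: t) (simp_all add: distrib_left)

lemma dersum_asum:
  "dersum A (asum f) vs = asum (\<lambda>v us. f (A v) us + dersum A (f v) us) vs"
proof (induction vs arbitrary: f)
  case (Cons v vs)
  have e: "asum f (v # us) = f v us - asum (\<lambda>w ws. f w (v # ws)) us" for us by simp
  show ?case
    using Cons.IH[of "\<lambda>w ws. f w (v # ws)"]
    by (simp add: dersum_diff asum_add asum_diff)
qed simp

lemma dersum_ecov_Cons:
  "dersum A (ecov (i # I)) vs
    = asum (\<lambda>v us. A v $ i * ecov I us + v $ i * dersum A (ecov I) us) vs"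
proof -
  have "ecov (i # I) = asum (\<lambda>v us. v $ i * ecov I us)" by (rule ext) (simp only: ecov_Cons)
  then show ?thesis by (simp only: dersum_asum dersum_scale)
qed

declare ecov.simps(2)[simp del]

lemma ecov_swap: "ecov (i # j # I) vs = - ecov (j # i # I) vs"
  unfolding ecov_Cons asum_scale[symmetric]
  by (subst asum_swap) (simp add: mult.left_commute)

text \<open>Swaps of neighbours suffice and fit recursion on lists. The element type is left open
  because both lists of vectors and lists of indices occur.\<close>

definition antisym_on :: "nat \<Rightarrow> ('b list \<Rightarrow> real) \<Rightarrow> bool" where
  "antisym_on n t \<longleftrightarrow>
     (\<forall>us a b ws. length us + 2 + length ws = n \<longrightarrow> t (us @ a # b # ws) = - t (us @ b # a # ws))"

lemma antisym_onI:
  "(\<And>us a b ws. length us + 2 + length ws = n \<Longrightarrow> t (us @ a # b # ws) = - t (us @ b # a # ws)) \<Longrightarrow>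
    antisym_on n t"
  unfolding antisym_on_def by (intro allI impI)

lemma antisym_onD:
  assumes "antisym_on n t" "length us + 2 + length ws = n"
  shows "t (us @ a # b # ws) = - t (us @ b # a # ws)"
  using assms(1)[unfolded antisym_on_def, rule_format, of us ws a b] assms(2) .

lemma antisym_on_Cons:
  assumes "antisym_on (Suc n) t"
  shows "antisym_on n (\<lambda>us. t (v # us))"
proof (rule antisym_onI)
  fix us ws :: "'a list" and a b
  assume "length us + 2 + length ws = n"
  then show "t (v # us @ a # b # ws) = - t (v # us @ b # a # ws)"
    using antisym_onD[OF assms, of "v # us" ws a b] by simp
qed

lemma asum_cong:
  assumes "\<And>v us. Suc (length us) = length vs \<Longrightarrow> f v us = g v us"
  shows "asum f vs = asum g vs"
  using assms
proof (induction vs arbitrary: f g)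
  case (Cons v vs)
  have "f v vs = g v vs" by (rule Cons.prems) simp
  moreover have "asum (\<lambda>w ws. f w (v # ws)) vs = asum (\<lambda>w ws. g w (v # ws)) vs"
    by (intro Cons.IH Cons.prems) simp
  ultimately show ?case by simp
qed simp

lemma asum_uminus: "asum (\<lambda>v us. - f v us) vs = - asum f vs"
  using asum_scale[of "-1" f vs] by simp

text \<open>If the swapped pair stands in front, the terms that remove \<open>a\<close> and
  \<open>b\<close> are exchanged and carry opposite signs, while all other terms change sign through
  \<open>f\<close>. A pair further back is reached by induction.\<close>

lemma antisym_on_asum:
  assumes "\<And>v. antisym_on n (f v)"
  shows "antisym_on (Suc n) (asum f)"
proof -
  have "asum f (us @ a # b # ws) = - asum f (us @ b # a # ws)"
    if "length us + 2 + length ws = Suc n" for us a b ws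
    using that assms
  proof (induction us arbitrary: f n)
    case Nil
    have "f w (a # b # us) = - f w (b # a # us)" if "Suc (length us) = length ws" for w us
      using antisym_onD[OF Nil(2), of "[]" us w a b] Nil(1) that by simp
    then have "asum (\<lambda>w us. f w (a # b # us)) ws = asum (\<lambda>w us. - f w (b # a # us)) ws"
      by (rule asum_cong)
    then show ?case by (simp add: asum_diff asum_uminus)
  next
    case (Cons u us)
    then obtain m where n: "n = Suc m" by (cases n) auto
    have "f u (us @ a # b # ws) = - f u (us @ b # a # ws)"
      using antisym_onD[OF Cons(3), of us ws u a b] Cons(2) by simp
    moreover have "asum (\<lambda>w xs. f w (u # xs)) (us @ a # b # ws)
        = - asum (\<lambda>w xs. f w (u # xs)) (us @ b # a # ws)"
      using Cons(2,3) unfolding n by (intro Cons.IH[of m]) (auto intro: antisym_on_Cons)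
    ultimately show ?case by simp
  qed
  then show ?thesis by (rule antisym_onI)
qed

lemma antisym_on_scale:
  assumes "antisym_on n t"
  shows "antisym_on n (\<lambda>us. a * t us)"
proof (rule antisym_onI)
  fix us ws :: "'a list" and u v
  assume "length us + 2 + length ws = n"
  then show "a * t (us @ u # v # ws) = - (a * t (us @ v # u # ws))"
    using antisym_onD[OF assms, of us ws u v] by simp
qed

lemma antisym_on_ecov: "antisym_on (length I) (ecov I)"
proof (induction I)
  case (Cons i I)
  have "ecov (i # I) = asum (\<lambda>v us. v $ i * ecov I us)" by (rule ext) (simp only: ecov_Cons)
  then show ?case using Cons by (simp add: antisym_on_asum antisym_on_scale)
qed (simp add: antisym_on_def)

lemma antisym_on_move:
  assumes "antisym_on n t" "length us + 1 + length ms + length ws = n"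
  shows "t (us @ ms @ a # ws) = (-1) ^ length ms * t (us @ a # ms @ ws)"
  using assms(2)
proof (induction ms arbitrary: us)
  case (Cons m ms)
  have "t (us @ (m # ms) @ a # ws) = t ((us @ [m]) @ ms @ a # ws)" by simp
  also have "\<dots> = (-1) ^ length ms * t (us @ m # a # ms @ ws)"
    using Cons.IH[of "us @ [m]"] Cons.prems by simp
  also have "\<dots> = (-1) ^ length (m # ms) * t (us @ a # (m # ms) @ ws)"
    using antisym_onD[OF assms(1), of us "ms @ ws" m a] Cons.prems by simp
  finally show ?case .
qed simp

text \<open>Move one copy of the repeated entry next to the other; swapping the two equal neighbours
  then gives t = - t.\<close>

lemma antisym_on_not_distinct:
  assumes "antisym_on n t" "length vs = n" "\<not> distinct vs"
  shows "t vs = 0"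
proof -
  obtain us a ms ws where vs: "vs = us @ [a] @ ms @ [a] @ ws"
    using not_distinct_decomp[OF assms(3)] by blast
  have "t ((us @ [a]) @ ms @ a # ws) = (-1) ^ length ms * t ((us @ [a]) @ a # ms @ ws)"
    using vs assms(2) by (intro antisym_on_move[OF assms(1)]) simp
  moreover have "t (us @ a # a # ms @ ws) = 0"
    using antisym_onD[OF assms(1), of us "ms @ ws" a a] vs assms(2) by simp
  ultimately show ?thesis using vs by simp
qed

text \<open>Absolute values avoid the sign of the permutation; this is enough to conclude that a
  value is zero.\<close>

lemma antisym_on_mset:
  assumes "antisym_on (length I) t" "mset I = mset J"
  shows "\<bar>t I\<bar> = \<bar>t J\<bar>"
  using assms
proof (induction I arbitrary: t J)
  case (Cons i I)
  then have "i \<in> set J" by (metis list.set_intros(1) set_mset_mset)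
  then obtain J1 J2 where J: "J = J1 @ i # J2" by (meson split_list)
  have l: "length J = length (i # I)" using Cons.prems(2) by (metis size_mset)
  have "\<bar>t J\<bar> = \<bar>t (i # J1 @ J2)\<bar>"
    using antisym_on_move[OF Cons.prems(1), of "[]" J1 J2 i] l unfolding J
    by (simp add: abs_mult)
  moreover have "\<bar>t (i # I)\<bar> = \<bar>t (i # J1 @ J2)\<bar>"
    using Cons.prems unfolding J by (intro Cons.IH) (simp_all add: antisym_on_Cons)
  ultimately show ?case by simp
qed simp

section \<open>Multilinearity and expansion in the standard basis\<close>

lemma multilinear_onD:
  "multilinear_on n t \<Longrightarrow> length us + 1 + length ws = n \<Longrightarrow> linear (\<lambda>v. t (us @ v # ws))"
  unfolding multilinear_on_def by blast

lemma multilinear_onI: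
  "(\<And>us ws. length us + 1 + length ws = n \<Longrightarrow> linear (\<lambda>v. t (us @ v # ws))) \<Longrightarrow> multilinear_on n t"
  unfolding multilinear_on_def by (intro allI impI)

lemma multilinear_on_Cons:
  assumes "multilinear_on (Suc n) t"
  shows "multilinear_on n (\<lambda>us. t (v # us))"
proof (rule multilinear_onI)
  fix us ws :: "(real^8) list"
  assume "length us + 1 + length ws = n"
  then show "linear (\<lambda>w. t (v # us @ w # ws))"
    using multilinear_onD[OF assms, of "v # us" ws] by simp
qed

lemma multilinear_on_hd: "multilinear_on (Suc n) t \<Longrightarrow> length vs = n \<Longrightarrow> linear (\<lambda>v. t (v # vs))"
  using multilinear_onD[of "Suc n" t "[]" vs] by simp

lemma linear_expand:
  assumes "linear (f :: real^8 \<Rightarrow> 'b::real_vector)"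
  shows "f v = (\<Sum>i\<in>UNIV. v $ i *\<^sub>R f (axis i 1))"
proof -
  have "f v = f (\<Sum>i\<in>UNIV. v $ i *\<^sub>R axis i 1)"
    using basis_expansion[of v] by (simp add: scalar_mult_eq_scaleR)
  then show ?thesis by (simp add: linear_sum[OF assms] linear_scale[OF assms])
qed

lemma multilinear_on_expand:
  assumes "multilinear_on (Suc n) t" "length vs = n"
  shows "t (v # vs) = (\<Sum>i\<in>UNIV. v $ i * t (axis i 1 # vs))"
  using linear_expand[OF multilinear_on_hd[OF assms], of v] by simp

lemma multilinear_on_eq_0:
  assumes "multilinear_on n t" "\<And>I. length I = n \<Longrightarrow> t (map basis_vec I) = 0" "length vs = n"
  shows "t vs = 0"
  using assms
proof (induction vs arbitrary: n t)
  case (Cons v vs)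
  then obtain m where n: "n = Suc m" "length vs = m" by auto
  have "t (axis i 1 # vs) = 0" for i
  proof (rule Cons.IH[of m "\<lambda>us. t (axis i 1 # us)"])
    show "multilinear_on m (\<lambda>us. t (axis i 1 # us))"
      using Cons.prems(1) unfolding n by (rule multilinear_on_Cons)
    show "t (axis i 1 # map basis_vec I) = 0" if "length I = m" for I
      using Cons.prems(2)[of "i # I"] that n by simp
  qed (use n in simp)
  then show ?case using multilinear_on_expand[OF Cons.prems(1)[unfolded n] n(2), of v] by (simp only: mult_zero_right sum.neutral_const)
next
  case Nil
  have "t (map basis_vec []) = 0" by (rule Nil(2)) (use Nil(3) in simp)
  then show ?case by simp
qed

lemma linear_asum:
  assumes "\<And>w ws. Suc (length ws) = length vs \<Longrightarrow> linear (\<lambda>x. g x w ws)"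
  shows "linear (\<lambda>x. asum (g x) vs)"
  using assms
proof (induction vs arbitrary: g)
  case Nil
  then show ?case by (simp add: linear_iff)
next
  case (Cons v vs)
  show ?case unfolding asum.simps
    by (intro linear_compose_sub Cons.prems Cons.IH) simp_all
qed

lemma multilinear_on_asum:
  assumes "\<And>v. multilinear_on n (f v)" "\<And>us. length us = n \<Longrightarrow> linear (\<lambda>v. f v us)"
  shows "multilinear_on (Suc n) (asum f)"
proof -
  have "linear (\<lambda>x. asum f (us @ x # ws))" if "length us + 1 + length ws = Suc n" for us ws
    using that assms
  proof (induction us arbitrary: f n)
    case Nil
    show ?case unfolding asum.simps append_Nil
    proof (intro linear_compose_sub linear_asum)
      show "linear (\<lambda>x. f x ws)" using Nil by simp
      show "linear (\<lambda>x. f w (x # us))" if "Suc (length us) = length ws" for w us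
        using Nil that multilinear_on_hd[of "length us" "f w" us] by simp
    qed
  next
    case (Cons u us)
    then obtain m where n: "n = Suc m" by (cases n) auto
    have "linear (\<lambda>x. f u (us @ x # ws))"
      using Cons.prems(1) Cons.prems(2)[of u] unfolding multilinear_on_def by simp
    moreover have "linear (\<lambda>x. asum (\<lambda>w xs. f w (u # xs)) (us @ x # ws))"
      using Cons.prems unfolding n by (intro Cons.IH[of m]) (auto intro: multilinear_on_Cons)
    ultimately show ?case by (simp add: linear_compose_sub)
  qed
  then show ?thesis by (rule multilinear_onI)
qed

lemma multilinear_on_scale: "multilinear_on n t \<Longrightarrow> multilinear_on n (\<lambda>us. a * t us)"
  unfolding multilinear_on_def using linear_compose_scale_right[where c = a] by fastforce

lemma multilinear_on_add:
  "multilinear_on n s \<Longrightarrow> multilinear_on n t \<Longrightarrow> multilinear_on n (\<lambda>us. s us + t us)"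
  unfolding multilinear_on_def by (auto intro: linear_compose_add)

lemma multilinear_on_ecov: "multilinear_on (length I) (ecov I)"
proof (induction I)
  case (Cons i I)
  have "ecov (i # I) = asum (\<lambda>v us. v $ i * ecov I us)" by (rule ext) (simp only: ecov_Cons)
  moreover have "linear (\<lambda>v. v $ i * r)" for r :: real
    by (simp add: linear_iff distrib_right)
  ultimately show ?case using Cons by (simp add: multilinear_on_asum multilinear_on_scale)
qed (simp add: multilinear_on_def)

section \<open>Contraction sums over lists of indices\<close>

lemma sum_lists_Suc:
  fixes g :: "'i::finite list \<Rightarrow> real"
  shows "(\<Sum>I\<in>{I. length I = Suc k}. g I) = (\<Sum>i\<in>UNIV. \<Sum>I\<in>{I. length I = k}. g (i # I))"
proof -
  have fin: "finite {I :: 'i list. length I = k}"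
    using finite_lists_length_eq[of "UNIV :: 'i set" k] by simp
  have "(\<Sum>I\<in>{I. length I = Suc k}. g I) = (\<Sum>(i, I)\<in>UNIV \<times> {I. length I = k}. g (i # I))"
    by (rule sum.reindex_bij_witness[of _ "\<lambda>(i, I). i # I" "\<lambda>I. (hd I, tl I)"])
       (auto simp: length_Suc_conv)
  then show ?thesis using fin by (simp add: sum.cartesian_product)
qed

text \<open>Bringing the entry singled out by \<open>asum\<close> to the front costs the same sign
  in \<open>F\<close> as in \<open>asum\<close>, so all Suc k positions contribute equally.\<close>

lemma sum_asum_antisym:
  fixes f :: "'i::finite \<Rightarrow> 'i list \<Rightarrow> real"
  assumes "antisym_on (Suc k) F"
  shows "(\<Sum>J\<in>{J. length J = Suc k}. asum f J * F J)
    = Suc k * (\<Sum>i\<in>UNIV. \<Sum>J\<in>{J. length J = k}. f i J * F (i # J))"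
  using assms
proof (induction k arbitrary: f F)
  case 0
  have "{J :: 'i list. length J = 0} = {[]}" by auto
  then show ?case by (simp add: sum_lists_Suc)
next
  case (Suc k)
  let ?L = "{J :: 'i list. length J = Suc k}"
  let ?M = "{J :: 'i list. length J = k}"
  have "(\<Sum>J\<in>?L. asum (\<lambda>w ws. f w (v # ws)) J * F (v # J))
      = Suc k * (\<Sum>w\<in>UNIV. \<Sum>J\<in>?M. f w (v # J) * F (v # w # J))" for v
    by (rule Suc.IH) (rule antisym_on_Cons[OF Suc.prems])
  moreover have "(\<Sum>w\<in>UNIV. \<Sum>J\<in>?M. f w (v # J) * F (v # w # J))
      = (\<Sum>w\<in>UNIV. \<Sum>J\<in>?M. - (f w (v # J) * F (w # v # J)))" for v
  proof (intro sum.cong refl)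
    fix w J assume "J \<in> ?M"
    then show "f w (v # J) * F (v # w # J) = - (f w (v # J) * F (w # v # J))"
      using antisym_onD[OF Suc.prems, of "[]" J v w] by simp
  qed
  ultimately have e: "(\<Sum>J\<in>?L. asum (\<lambda>w ws. f w (v # ws)) J * F (v # J))
      = - (Suc k * (\<Sum>w\<in>UNIV. \<Sum>J\<in>?M. f w (v # J) * F (w # v # J)))" for v
    by (simp only: sum_negf mult_minus_right)
  have "(\<Sum>v\<in>UNIV. \<Sum>J\<in>?L. asum (\<lambda>w ws. f w (v # ws)) J * F (v # J))
      = - (Suc k * (\<Sum>v\<in>UNIV. \<Sum>w\<in>UNIV. \<Sum>J\<in>?M. f w (v # J) * F (w # v # J)))"
    unfolding e sum_distrib_left sum_negf ..
  also have "(\<Sum>v\<in>UNIV. \<Sum>w\<in>UNIV. \<Sum>J\<in>?M. f w (v # J) * F (w # v # J))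
      = (\<Sum>w\<in>UNIV. \<Sum>J\<in>?L. f w J * F (w # J))"
    unfolding sum_lists_Suc by (rule sum.swap)
  finally have e2: "(\<Sum>v\<in>UNIV. \<Sum>J\<in>?L. asum (\<lambda>w ws. f w (v # ws)) J * F (v # J))
      = - (Suc k * (\<Sum>w\<in>UNIV. \<Sum>J\<in>?L. f w J * F (w # J)))" .
  have "(\<Sum>J\<in>{J. length J = Suc (Suc k)}. asum f J * F J)
      = (\<Sum>v\<in>UNIV. \<Sum>J\<in>?L. f v J * F (v # J))
        - (\<Sum>v\<in>UNIV. \<Sum>J\<in>?L. asum (\<lambda>w ws. f w (v # ws)) J * F (v # J))"
    unfolding sum_lists_Suc[of _ "Suc k"] by (simp add: left_diff_distrib sum_subtractf)
  then show ?case unfolding e2 by (simp add: algebra_simps)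
qed

lemma asum_map: "asum f (map h vs) = asum (\<lambda>v us. f (h v) (map h us)) vs"
  by (induction vs arbitrary: f) simp_all

lemma sum_ecov_antisym:
  assumes "antisym_on (length I) F"
  shows "(\<Sum>J\<in>{J. length J = length I}. ecov I (map basis_vec J) * F J) = fact (length I) * F I"
  using assms
proof (induction I arbitrary: F)
  case Nil
  have "{J :: 8 list. length J = 0} = {[]}" by auto
  then show ?case by simp
next
  case (Cons i I)
  let ?M = "{J :: 8 list. length J = length I}"
  have "(\<Sum>J\<in>{J. length J = length (i # I)}. ecov (i # I) (map basis_vec J) * F J)
      = Suc (length I) * (\<Sum>v\<in>UNIV. \<Sum>J\<in>?M. (axis v 1 :: real^8) $ i * ecov I (map basis_vec J) * F (v # J))"
    unfolding ecov_Cons asum_map using sum_asum_antisym[of "length I" F] Cons.prems by simp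
  also have "(\<Sum>v\<in>UNIV. \<Sum>J\<in>?M. (axis v 1 :: real^8) $ i * ecov I (map basis_vec J) * F (v # J))
      = (\<Sum>v\<in>UNIV. if v = i then (\<Sum>J\<in>?M. ecov I (map basis_vec J) * F (i # J)) else 0)"
    by (rule sum.cong) (auto simp: axis_def)
  also have "\<dots> = fact (length I) * F (i # I)"
    using Cons.IH[of "\<lambda>J. F (i # J)"] Cons.prems by (simp add: antisym_on_Cons)
  finally show ?case by simp
qed

section \<open>The eight indices and the determinant as a form\<close>

lemma all_8: "(\<forall>i::8. Q i) \<longleftrightarrow> Q 1 \<and> Q 2 \<and> Q 3 \<and> Q 4 \<and> Q 5 \<and> Q 6 \<and> Q 7 \<and> Q 8"
proof -
  have "(\<forall>i::8. Q i) \<longleftrightarrow> (\<forall>i\<in>{1,2,3,4,5,6,7,8}. Q i)"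
    unfolding univ_8[symmetric] by simp
  then show ?thesis by simp
qed

lemma sum_8: "(\<Sum>i\<in>(UNIV::8 set). f i) = f 1 + f 2 + f 3 + f 4 + f 5 + f 6 + f 7 + f 8"
  unfolding univ_8 by (simp add: add.assoc)

text \<open>
  The position of the index \<open>i\<close> in \<open>1, \<dots>, 8\<close>, counted from 0 (recall that \<open>8 = 0\<close> in the index type).
\<close>

definition ix :: "8 \<Rightarrow> nat" where
  "ix i = (if i = 1 then 0 else if i = 2 then 1 else if i = 3 then 2 else if i = 4 then 3
     else if i = 5 then 4 else if i = 6 then 5 else if i = 7 then 6 else 7)"

lemma ix_less: "ix i < 8"
  by (simp add: ix_def)

lemma ix_inj: "ix i = ix j \<longleftrightarrow> i = j"
proof -
  have "\<forall>i j. ix i = ix j \<longrightarrow> i = j" unfolding all_8 by (simp add: ix_def)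
  then show ?thesis by blast
qed

lemma ix_surj: "k < 8 \<Longrightarrow> \<exists>i. ix i = k"
proof -
  assume "k < 8"
  then have "k \<in> {0,1,2,3,4,5,6,7}" by auto
  moreover have "ix 1 = 0" "ix 2 = 1" "ix 3 = 2" "ix 4 = 3" "ix 5 = 4" "ix 6 = 5" "ix 7 = 6" "ix 8 = 7"
    by (simp_all add: ix_def)
  ultimately show ?thesis by blast
qed

lemma vector_nth_8:
  assumes "length vs = 8"
  shows "(vector vs :: real^8^8) $ i = vs ! ix i"
proof -
  obtain a b c d e f g h where vs: "vs = [a,b,c,d,e,f,g,h]"
    using assms by (auto simp: length_Suc_conv numeral_eq_Suc)
  have "\<forall>i. (vector vs :: real^8^8) $ i = vs ! ix i"
    unfolding all_8 vs by (simp add: vector_def ix_def)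
  then show ?thesis ..
qed

definition vdet :: tensor where
  "vdet vs = det (vector vs :: real^8^8)"

lemma multilinear_on_vdet: "multilinear_on 8 vdet"
proof (rule multilinear_onI)
  fix us ws :: "(real^8) list"
  assume l: "length us + 1 + length ws = 8"
  then obtain k where k: "ix k = length us" using ix_surj[of "length us"] by auto
  have r: "(vector (us @ v # ws) :: real^8^8)
      = (\<chi> i. if i = k then v else (us @ 0 # ws) ! ix i)" for v
    using l by (simp add: vec_eq_iff vector_nth_8 nth_append nth_Cons' k[symmetric] ix_inj)
  show "linear (\<lambda>v. vdet (us @ v # ws))"
    unfolding vdet_def r
  proof (rule linearI)
    let ?c = "\<lambda>i. (us @ 0 # ws) ! ix i"
    show "det (\<chi> i. if i = k then x + y else ?c i)
        = det (\<chi> i. if i = k then x else ?c i) + det (\<chi> i. if i = k then y else ?c i)" for x y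
      by (rule det_row_add)
    show "det (\<chi> i. if i = k then a *\<^sub>R x else ?c i) = a *\<^sub>R det (\<chi> i. if i = k then x else ?c i)" for a x
      using det_row_mul[of k a "\<lambda>_. x" ?c] unfolding scalar_mult_eq_scaleR real_scaleR_def .
  qed
qed

lemma antisym_on_vdet: "antisym_on 8 vdet"
proof (rule antisym_onI)
  fix us ws :: "(real^8) list" and a b
  assume l: "length us + 2 + length ws = 8"
  then obtain k where k: "ix k = length us" using ix_surj[of "length us"] by auto
  from l obtain m where m: "ix m = Suc (length us)" using ix_surj[of "Suc (length us)"] by auto
  let ?A = "vector (us @ b # a # ws) :: real^8^8"
  have km: "k \<noteq> m" using k m by auto
  have "(vector (us @ a # b # ws) :: real^8^8) $ i = ?A $ (Transposition.transpose k m i)" for i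
  proof (cases "i = k \<or> i = m")
    case True
    then show ?thesis using l k m km by (auto simp: vector_nth_8 nth_append)
  next
    case False
    then have "ix i \<noteq> ix k" "ix i \<noteq> ix m" unfolding ix_inj by auto
    then have "ix i \<noteq> length us" "ix i \<noteq> Suc (length us)" unfolding k m .
    moreover have "(us @ a # b # ws) ! n = (us @ b # a # ws) ! n"
      if "n \<noteq> length us" "n \<noteq> Suc (length us)" for n
      using that by (auto simp: nth_append nth_Cons')
    ultimately show ?thesis using l False by (simp add: vector_nth_8 transpose_apply_other)
  qed
  then have e: "(vector (us @ a # b # ws) :: real^8^8) = (\<chi> i. ?A $ (Transposition.transpose k m i))"
    by (simp add: vec_eq_iff)
  show "vdet (us @ a # b # ws) = - vdet (us @ b # a # ws)"
    unfolding vdet_def e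
    by (subst det_permute_rows) (auto simp: permutes_swap_id sign_swap_id km)
qed

text \<open>
  Forms with explicit coefficients are represented by lists of terms, on which contraction with
  basis vectors (\<open>contr\<close>), the exterior derivative (\<open>dlist\<close>) and derivations (\<open>alist\<close>) are computed
  by simplification.
\<close>

definition lform :: "(real \<times> 8 list) list \<Rightarrow> tensor" where
  "lform L vs = (\<Sum>(a, I)\<leftarrow>L. a * ecov I vs)"

lemma lform_Nil [simp]: "lform [] vs = 0"
  and lform_Cons [simp]: "lform ((a, I) # L) vs = a * ecov I vs + lform L vs"
  by (simp_all add: lform_def)

lemma lform_append: "lform (L @ M) vs = lform L vs + lform M vs"
  by (simp add: lform_def)

lemma lform_scale: "lform (map (\<lambda>(b, J). (a * b, J)) L) vs = a * lform L vs"
  by (induction L) (auto simp: distrib_left)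

lemma lform_wedge:
  "lform (map (\<lambda>(b, J). (b, j # J)) L) vs = asum (\<lambda>v us. v $ j * lform L us) vs"
  by (induction L) (auto simp: asum_zero asum_add asum_scale ecov_Cons distrib_left mult.left_commute)

lemma lform_wedge_minus:
  "lform (map (\<lambda>(b, J). (- b, j # J)) L) vs = - asum (\<lambda>v us. v $ j * lform L us) vs"
  unfolding lform_wedge[symmetric] by (induction L) auto

lemma basis_vec_nth: "basis_vec i $ j = (if i = j then 1 else 0)"
  by (simp add: axis_def)

fun contr :: "8 \<Rightarrow> 8 list \<Rightarrow> (real \<times> 8 list) list" where
  "contr i [] = []"
| "contr i (j # J) = (if i = j then [(1, J)] else []) @ map (\<lambda>(b, K). (- b, j # K)) (contr i J)"

lemma ecov_axis:
  assumes "length J = Suc (length ws)"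
  shows "ecov J (axis i 1 # ws) = lform (contr i J) ws"
  using assms
proof (induction J arbitrary: ws)
  case (Cons j J)
  have "asum (\<lambda>v us. v $ j * ecov J (axis i 1 # us)) ws
      = asum (\<lambda>v us. v $ j * lform (contr i J) us) ws"
    using Cons by (intro asum_cong) simp
  then show ?case by (simp add: ecov_Cons lform_append lform_wedge_minus basis_vec_nth)
qed simp

fun contrs :: "8 list \<Rightarrow> 8 list \<Rightarrow> (real \<times> 8 list) list" where
  "contrs [] J = [(1, J)]"
| "contrs (i # I) J = concat (map (\<lambda>(a, K). map (\<lambda>(b, M). (a * b, M)) (contrs I K)) (contr i J))"

lemma contr_length: "(a, K) \<in> set (contr i J) \<Longrightarrow> Suc (length K) = length J"
  by (induction J arbitrary: a K) (auto split: if_splits)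

lemma ecov_axes:
  assumes "length J = length I + length ws"
  shows "ecov J (map basis_vec I @ ws) = lform (contrs I J) ws"
  using assms
proof (induction I arbitrary: J)
  case (Cons i I)
  have IH: "ecov K (map basis_vec I @ ws) = lform (contrs I K) ws"
    if "length K = length I + length ws" for K
    using Cons.IH that .
  have "lform L (map basis_vec I @ ws)
      = lform (concat (map (\<lambda>(a, K). map (\<lambda>(b, M). (a * b, M)) (contrs I K)) L)) ws"
    if "\<And>a K. (a, K) \<in> set L \<Longrightarrow> length K = length I + length ws" for L
    using that
  proof (induction L)
    case (Cons p L)
    obtain a K where p: "p = (a, K)" by force
    have "length K = length I + length ws" using Cons.prems[of a K] p by simp
    moreover have "lform L (map basis_vec I @ ws)
        = lform (concat (map (\<lambda>(a, K). map (\<lambda>(b, M). (a * b, M)) (contrs I K)) L)) ws"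
      by (rule Cons.IH) (use Cons.prems in auto)
    ultimately show ?case by (simp add: p lform_append lform_scale IH)
  qed simp
  then show ?case
    using Cons.prems contr_length[of _ _ i J] by (simp add: ecov_axis)
qed simp

lemma antisym_on_add:
  assumes "antisym_on n s" "antisym_on n t"
  shows "antisym_on n (\<lambda>us. s us + t us)"
proof (rule antisym_onI)
  fix us ws :: "'a list" and u v
  assume "length us + 2 + length ws = n"
  then show "s (us @ u # v # ws) + t (us @ u # v # ws) = - (s (us @ v # u # ws) + t (us @ v # u # ws))"
    using antisym_onD[OF assms(1), of us ws u v] antisym_onD[OF assms(2), of us ws u v] by simp
qed

text \<open>The difference is multilinear and antisymmetric of top degree, hence determined by its
  value on one ordered basis. This turns the determinant in the Hodge star into a term that
  \<open>contrs\<close> can evaluate.\<close>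

lemma vdet_eq_ecov:
  assumes "length vs = 8"
  shows "vdet vs = ecov [1,2,3,4,5,6,7,8] vs"
proof -
  let ?J = "[1,2,3,4,5,6,7,8] :: 8 list"
  let ?t = "\<lambda>us. vdet us + (-1) * ecov ?J us"
  have l: "length ?J = 8" by simp
  have multi: "multilinear_on 8 ?t"
    by (intro multilinear_on_add multilinear_on_scale multilinear_on_vdet multilinear_on_ecov[of ?J, unfolded l])
  have anti: "antisym_on 8 ?t"
    by (intro antisym_on_add antisym_on_scale antisym_on_vdet antisym_on_ecov[of ?J, unfolded l])
  have base: "?t (map basis_vec ?J) = 0"
  proof -
    have "(vector (map basis_vec ?J) :: real^8^8) $ i = mat 1 $ i" for i
    proof -
      have "\<forall>i. ?J ! ix i = i"
        unfolding all_8 by (simp add: ix_def)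
      then have "map basis_vec ?J ! ix i = basis_vec i"
        using ix_less[of i] by (subst nth_map) simp_all
      moreover have "mat 1 $ i = (basis_vec i :: real^8)"
        by (simp add: mat_def axis_def vec_eq_iff)
      ultimately show ?thesis using vector_nth_8[of "map basis_vec ?J" i] by simp
    qed
    then have "vdet (map basis_vec ?J) = 1"
      unfolding vdet_def by (metis det_I vec_eq_iff)
    moreover have "ecov ?J (map basis_vec ?J) = 1"
      using ecov_axes[of ?J ?J "[]"] by simp
    ultimately show ?thesis by simp
  qed
  have "?t vs = 0"
  proof (rule multilinear_on_eq_0[OF multi _ assms])
    fix I :: "8 list" assume I: "length I = 8"
    have a: "antisym_on 8 (\<lambda>K. ?t (map basis_vec K))"
    proof (rule antisym_onI)
      fix us ws :: "8 list" and i j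
      assume "length us + 2 + length ws = 8"
      then show "?t (map basis_vec (us @ i # j # ws)) = - ?t (map basis_vec (us @ j # i # ws))"
        using antisym_onD[OF anti, of "map basis_vec us" "map basis_vec ws" "axis i 1" "axis j 1"] by simp
    qed
    show "?t (map basis_vec I) = 0"
    proof (cases "distinct I")
      case True
      then have "card (set I) = card (UNIV :: 8 set)" using I by (simp add: distinct_card)
      then have "set I = UNIV" by (intro card_subset_eq) auto
      also have "UNIV = set ?J" unfolding univ_8 by simp
      finally have "mset I = mset ?J" using True by (subst set_eq_iff_mset_eq_distinct[symmetric]) auto
      then have "\<bar>?t (map basis_vec I)\<bar> = \<bar>?t (map basis_vec ?J)\<bar>"
        using antisym_on_mset[of I "\<lambda>K. ?t (map basis_vec K)" ?J] a I by simp
      then show ?thesis using base by linarith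
    next
      case False
      then show ?thesis using antisym_on_not_distinct[OF a I] by simp
    qed
  qed
  then show ?thesis by simp
qed

text \<open>The Hodge star of the Euclidean inner product, that is, \<open>hodge_star\<close> read
  in an orthonormal, positively oriented coframe.\<close>

definition star0 :: "nat \<Rightarrow> tensor \<Rightarrow> tensor" where
  "star0 k t ws = (\<Sum>I\<in>{I. length I = k}. t (map basis_vec I) * vdet (map basis_vec I @ ws)) / fact k"

text \<open>Contracting \<open>ecov I\<close> with an antisymmetric coefficient picks out the list
  \<open>I\<close> with factor k!, which leaves the volume form contracted with the basis vectors of
  \<open>I\<close>.\<close>

lemma star0_ecov:
  assumes "length I + length ws = 8"
  shows "star0 (length I) (ecov I) ws = lform (contrs I [1,2,3,4,5,6,7,8]) ws"
proof -
  have "antisym_on (length I) (\<lambda>J. vdet (map basis_vec J @ ws))"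
  proof (rule antisym_onI)
    fix us vs :: "8 list" and a b
    assume "length us + 2 + length vs = length I"
    then show "vdet (map basis_vec (us @ a # b # vs) @ ws) = - vdet (map basis_vec (us @ b # a # vs) @ ws)"
      using antisym_onD[OF antisym_on_vdet, of "map basis_vec us" "map basis_vec vs @ ws" "axis a 1" "axis b 1"] assms
      by simp
  qed
  from sum_ecov_antisym[OF this] show ?thesis
    using assms by (simp add: star0_def vdet_eq_ecov ecov_axes)
qed

lemma star0_lform:
  assumes "\<And>a I. (a, I) \<in> set L \<Longrightarrow> length I = k" "k + length ws = 8"
  shows "star0 k (lform L) ws
    = lform (concat (map (\<lambda>(a, I). map (\<lambda>(b, M). (a * b, M)) (contrs I [1,2,3,4,5,6,7,8])) L)) ws"
  using assms(1)
proof (induction L)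
  case (Cons p L)
  obtain a I where p: "p = (a, I)" by force
  have "star0 k (lform (p # L)) ws = a * star0 k (ecov I) ws + star0 k (lform L) ws"
    by (simp add: p star0_def distrib_right sum.distrib add_divide_distrib sum_distrib_left mult.assoc)
  also have "star0 k (lform L) ws
      = lform (concat (map (\<lambda>(a, I). map (\<lambda>(b, M). (a * b, M)) (contrs I [1,2,3,4,5,6,7,8])) L)) ws"
    by (rule Cons.IH) (use Cons.prems in auto)
  also have "star0 k (ecov I) ws = lform (contrs I [1,2,3,4,5,6,7,8]) ws"
    using star0_ecov[of I ws] Cons.prems[of a I] p assms(2) by simp
  finally show ?case by (simp only: p list.map concat.simps prod.case lform_append lform_scale)
qed (simp add: star0_def)

text \<open>
  The exterior derivative of a form with constant coefficients in a coframe whose derivative is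
  given by \<open>c\<close>.
\<close>

definition dext :: "(real^8 \<Rightarrow> real^8 \<Rightarrow> real^8) \<Rightarrow> tensor \<Rightarrow> tensor" where
  "dext c t vs = asum (\<lambda>u. dersum (c u) t) vs"

lemma dersum_cong:
  assumes "\<And>us. length us = length vs \<Longrightarrow> s us = t us"
  shows "dersum A s vs = dersum A t vs"
  using assms unfolding dersum_conv_sum by simp

lemma dext_cong:
  assumes "\<And>us. Suc (length us) = length vs \<Longrightarrow> s us = t us"
  shows "dext c s vs = dext c t vs"
  unfolding dext_def using assms by (intro asum_cong dersum_cong) simp

text \<open>A triple \<open>(a, p, q)\<close> in \<open>D i\<close> stands for a summand a ep \<and>
  eq of dei; the minus sign is that of the Leibniz rule.\<close>

fun dlist :: "(8 \<Rightarrow> (real \<times> 8 \<times> 8) list) \<Rightarrow> 8 list \<Rightarrow> (real \<times> 8 list) list" where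
  "dlist D [] = []"
| "dlist D (i # I) = map (\<lambda>(a, p, q). (a, p # q # I)) (D i) @ map (\<lambda>(b, J). (- b, i # J)) (dlist D I)"

lemma asum_fun:
  "asum (\<lambda>v us. 0) = (\<lambda>vs. 0)"
  "asum (\<lambda>v us. f v us + g v us) = (\<lambda>vs. asum f vs + asum g vs)"
  "asum (\<lambda>v us. a * f v us) = (\<lambda>vs. a * asum f vs)"
  by (simp_all add: fun_eq_iff asum_zero asum_add asum_scale)

text \<open>\<open>asum_swap\<close> moves the differentiating slot past the first covector. The map
  \<open>c\<close> may fail to be antisymmetric: the alternating sum only sees
  \<open>c u v - c v u\<close>.\<close>

lemma dext_ecov:
  assumes "\<And>u v i. c u v $ i = (\<Sum>(a, p, q)\<leftarrow>D i. a * (u $ p * v $ q))"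
    and "length vs = Suc (length I)"
  shows "dext c (ecov I) vs = lform (dlist D I) vs"
  using assms(2)
proof (induction I arbitrary: vs)
  case Nil
  then obtain v where "vs = [v]" by (auto simp: length_Suc_conv)
  then show ?case by (simp add: dext_def)
next
  case (Cons i I)
  have s: "asum (\<lambda>u. asum (\<lambda>v us. (\<Sum>(a, p, q)\<leftarrow>L. a * (u $ p * v $ q)) * ecov I us)) vs
      = lform (map (\<lambda>(a, p, q). (a, p # q # I)) L) vs" for L
    by (induction L)
       (auto simp: asum_zero asum_fun asum_add asum_scale ecov_Cons distrib_right mult.assoc)
  have "dext c (ecov (i # I)) vs
      = asum (\<lambda>u. asum (\<lambda>v us. c u v $ i * ecov I us)) vs
        + asum (\<lambda>u. asum (\<lambda>v us. v $ i * dersum (c u) (ecov I) us)) vs"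
    unfolding dext_def dersum_ecov_Cons asum_add ..
  also have "asum (\<lambda>u. asum (\<lambda>v us. v $ i * dersum (c u) (ecov I) us)) vs
      = - asum (\<lambda>v us. v $ i * dext c (ecov I) us) vs"
    by (subst asum_swap) (simp add: dext_def asum_fun)
  also have "asum (\<lambda>v us. v $ i * dext c (ecov I) us) vs
      = asum (\<lambda>v us. v $ i * lform (dlist D I) us) vs"
    using Cons by (intro asum_cong) simp
  finally show ?case
    unfolding assms(1) s by (simp add: lform_append lform_wedge_minus)
qed

lemma dersum_fun:
  "dersum A (\<lambda>us. s us + t us) = (\<lambda>vs. dersum A s vs + dersum A t vs)"
  "dersum A (\<lambda>us. a * t us) = (\<lambda>vs. a * dersum A t vs)"
  by (simp_all add: fun_eq_iff dersum_add dersum_scale)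

lemma dext_lform:
  assumes "\<And>u v i. c u v $ i = (\<Sum>(a, p, q)\<leftarrow>D i. a * (u $ p * v $ q))"
    and "\<And>a I. (a, I) \<in> set L \<Longrightarrow> length I = k" "length vs = Suc k"
  shows "dext c (lform L) vs
    = lform (concat (map (\<lambda>(a, I). map (\<lambda>(b, M). (a * b, M)) (dlist D I)) L)) vs"
  using assms(2)
proof (induction L)
  case Nil
  have e: "(\<lambda>u. dersum (c u) (lform [])) = (\<lambda>u us. 0)" by (intro ext) (simp add: dersum_conv_sum)
  show ?case unfolding dext_def e by (simp add: asum_zero)
next
  case (Cons p L)
  obtain a I where p: "p = (a, I)" by force
  have "lform (p # L) = (\<lambda>us. a * ecov I us + lform L us)" by (rule ext) (simp add: p)
  then have "dext c (lform (p # L)) vs = a * dext c (ecov I) vs + dext c (lform L) vs"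
    by (simp only: dext_def dersum_fun asum_add asum_scale)
  also have "dext c (lform L) vs = lform (concat (map (\<lambda>(a, I). map (\<lambda>(b, M). (a * b, M)) (dlist D I)) L)) vs"
    by (rule Cons.IH) (use Cons.prems in auto)
  also have "dext c (ecov I) vs = lform (dlist D I) vs"
    using dext_ecov[OF assms(1), of vs I] Cons.prems[of a I] p assms(3) by simp
  finally show ?case by (simp only: p list.map concat.simps prod.case lform_append lform_scale)
qed

fun alist :: "(8 \<Rightarrow> (real \<times> 8) list) \<Rightarrow> 8 list \<Rightarrow> (real \<times> 8 list) list" where
  "alist R [] = []"
| "alist R (i # I) = map (\<lambda>(a, p). (a, p # I)) (R i) @ map (\<lambda>(b, J). (b, i # J)) (alist R I)"

lemma dersum_ecov:
  assumes "\<And>v i. A v $ i = (\<Sum>(a, p)\<leftarrow>R i. a * v $ p)" and "length vs = length I"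
  shows "dersum A (ecov I) vs = lform (alist R I) vs"
  using assms(2)
proof (induction I arbitrary: vs)
  case (Cons i I)
  have s: "asum (\<lambda>v us. (\<Sum>(a, p)\<leftarrow>L. a * v $ p) * ecov I us) vs
      = lform (map (\<lambda>(a, p). (a, p # I)) L) vs" for L
    by (induction L)
       (auto simp: asum_zero asum_add asum_scale ecov_Cons distrib_right mult.assoc)
  have "asum (\<lambda>v us. v $ i * dersum A (ecov I) us) vs
      = asum (\<lambda>v us. v $ i * lform (alist R I) us) vs"
    using Cons by (intro asum_cong) simp
  then show ?case
    unfolding dersum_ecov_Cons asum_add assms(1) s by (simp add: lform_append lform_wedge)
qed simp

lemma dersum_lform:
  assumes "\<And>v i. A v $ i = (\<Sum>(a, p)\<leftarrow>R i. a * v $ p)"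
    and "\<And>a I. (a, I) \<in> set L \<Longrightarrow> length I = length vs"
  shows "dersum A (lform L) vs
    = lform (concat (map (\<lambda>(a, I). map (\<lambda>(b, M). (a * b, M)) (alist R I)) L)) vs"
  using assms(2)
proof (induction L)
  case Nil
  then show ?case by (simp add: dersum_conv_sum)
next
  case (Cons p L)
  obtain a I where p: "p = (a, I)" by force
  have "lform (p # L) = (\<lambda>us. a * ecov I us + lform L us)" by (rule ext) (simp add: p)
  then have "dersum A (lform (p # L)) vs = a * dersum A (ecov I) vs + dersum A (lform L) vs"
    by (simp only: dersum_add dersum_scale)
  also have "dersum A (lform L) vs = lform (concat (map (\<lambda>(a, I). map (\<lambda>(b, M). (a * b, M)) (alist R I)) L)) vs"
    by (rule Cons.IH) (use Cons.prems in auto)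
  also have "dersum A (ecov I) vs = lform (alist R I) vs"
    using dersum_ecov[OF assms(1), of vs I] Cons.prems[of a I] p by simp
  finally show ?case by (simp only: p list.map concat.simps prod.case lform_append lform_scale)
qed

lemma lform_alt_forms:
  assumes "\<And>a I. (a, I) \<in> set L \<Longrightarrow> length I = k"
  shows "lform L \<in> alt_forms k"
  using assms
proof (induction L)
  case Nil
  then show ?case by (simp add: alt_forms_def multilinear_on_def alternating_on_def linear_iff)
next
  case (Cons p L)
  obtain a I where p: "p = (a, I)" by force
  have I: "length I = k" using Cons.prems[of a I] p by simp
  have e: "lform (p # L) = (\<lambda>us. a * ecov I us + lform L us)" by (rule ext) (simp add: p)
  have "lform L \<in> alt_forms k" by (rule Cons.IH) (use Cons.prems in auto)
  then show ?case
    using antisym_on_not_distinct[OF antisym_on_ecov[of I]] multilinear_on_ecov[of I]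
    unfolding e alt_forms_def alternating_on_def I
    by (auto intro: multilinear_on_add multilinear_on_scale)
qed

lemma ecov_swap1: "ecov (a # i # j # I) vs = - ecov (a # j # i # I) vs"
  and ecov_swap2: "ecov (a # b # i # j # I) vs = - ecov (a # b # j # i # I) vs"
  and ecov_swap3: "ecov (a # b # c # i # j # I) vs = - ecov (a # b # c # j # i # I) vs"
  and ecov_swap4: "ecov (a # b # c # d # i # j # I) vs = - ecov (a # b # c # d # j # i # I) vs"
proof -
  have cong: "ecov (a # I) vs = - ecov (a # J) vs" if "\<And>vs. ecov I vs = - ecov J vs" for a I J vs
    unfolding ecov_Cons that by (simp add: asum_uminus)
  show 1: "ecov (a # i # j # I) vs = - ecov (a # j # i # I) vs" for a vs
    by (intro cong ecov_swap)
  show 2: "ecov (a # b # i # j # I) vs = - ecov (a # b # j # i # I) vs" for a b vs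
    by (intro cong ecov_swap)
  show 3: "ecov (a # b # c # i # j # I) vs = - ecov (a # b # c # j # i # I) vs" for a b c vs
    by (intro cong ecov_swap)
  show "ecov (a # b # c # d # i # j # I) vs = - ecov (a # b # c # d # j # i # I) vs"
    by (intro cong ecov_swap)
qed

lemma ecov_repeat:
  "ecov (i # i # I) vs = 0"
  "ecov (a # i # i # I) vs = 0"
  "ecov (a # b # i # i # I) vs = 0"
  "ecov (a # b # c # i # i # I) vs = 0"
  "ecov (a # b # c # d # i # i # I) vs = 0"
  using ecov_swap[of i i I vs] ecov_swap1[of a i i I vs] ecov_swap2[of a b i i I vs]
    ecov_swap3[of a b c i i I vs] ecov_swap4[of a b c d i i I vs] by simp_all

text \<open>The guard sorts the indices and prevents looping, so that together with
  \<open>ecov_repeat\<close> equal monomials meet and cancel. The five positions cover degree six,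
  the highest in which a derivative has to vanish.\<close>

lemma ecov_sort:
  "ix j < ix i \<Longrightarrow> ecov (i # j # I) vs = - ecov (j # i # I) vs"
  "ix j < ix i \<Longrightarrow> ecov (a # i # j # I) vs = - ecov (a # j # i # I) vs"
  "ix j < ix i \<Longrightarrow> ecov (a # b # i # j # I) vs = - ecov (a # b # j # i # I) vs"
  "ix j < ix i \<Longrightarrow> ecov (a # b # c # i # j # I) vs = - ecov (a # b # c # j # i # I) vs"
  "ix j < ix i \<Longrightarrow> ecov (a # b # c # d # i # j # I) vs = - ecov (a # b # c # d # j # i # I) vs"
  by (rule ecov_swap ecov_swap1 ecov_swap2 ecov_swap3 ecov_swap4)+

section \<open>Smooth functions\<close>

text \<open>Needed because a chart change agrees with one lattice translation only near each point;
  the translation may differ between components of the overlap.\<close>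

lemma Ck_on_local:
  assumes "\<And>x. x \<in> S \<Longrightarrow> \<exists>W g. open W \<and> x \<in> W \<and> Ck_on k W g \<and> (\<forall>y\<in>W. f y = g y)"
  shows "Ck_on k S f"
  using assms
proof (induction k arbitrary: f)
  case 0
  have "continuous_on S f"
  proof (rule continuous_at_imp_continuous_on, rule ballI)
    fix x assume "x \<in> S"
    then obtain W g where W: "open W" "x \<in> W" "continuous_on W g" "\<forall>y\<in>W. f y = g y"
      using 0[of x] by auto
    have "continuous_on W f = continuous_on W g" using W(4) by (intro continuous_on_cong) auto
    then show "isCont f x" using W continuous_on_eq_continuous_at[OF W(1)] by blast
  qed
  then show ?case by simp
next
  case (Suc k)
  have "f differentiable (at x)
      \<and> (\<exists>W g. open W \<and> x \<in> W \<and> Ck_on k W g \<and> (\<forall>y\<in>W. frechet_derivative f (at y) v = g y))"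
    if x: "x \<in> S" for x v
  proof -
    obtain W g where W: "open W" "x \<in> W" "Ck_on (Suc k) W g" "\<forall>y\<in>W. f y = g y"
      using Suc.prems[OF x] by blast
    have d: "(f has_derivative frechet_derivative g (at y)) (at y)" if "y \<in> W" for y
    proof -
      have "(g has_derivative frechet_derivative g (at y)) (at y)"
        using W(3) that by (simp add: frechet_derivative_works)
      then show ?thesis
        by (rule has_derivative_transform_within_open[OF _ W(1) that]) (use W(4) in simp)
    qed
    have "frechet_derivative f (at y) v = frechet_derivative g (at y) v" if "y \<in> W" for y
      using frechet_derivative_at[OF d[OF that]] by simp
    moreover have "Ck_on k W (\<lambda>y. frechet_derivative g (at y) v)" using W(3) by simp
    ultimately show ?thesis using W(1,2) d[OF W(2)] unfolding differentiable_def by blast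
  qed
  then show ?case using Suc.IH by simp
qed

lemma Ck_on_const: "Ck_on k S (\<lambda>x. c)"
  by (induction k arbitrary: c) simp_all

lemma Ck_on_constant_derivative:
  assumes "\<And>x. (f has_derivative f') (at x)"
  shows "Ck_on k S f"
proof (cases k)
  case 0
  then show ?thesis
    using assms by (auto intro!: continuous_at_imp_continuous_on has_derivative_continuous)
next
  case (Suc m)
  have "frechet_derivative f (at x) = f'" for x
    using frechet_derivative_at[OF assms] by simp
  then show ?thesis using Suc assms by (auto simp: Ck_on_const differentiable_def)
qed

lemma Ck_on_cong:
  assumes "\<And>x. x \<in> S \<Longrightarrow> f x = g x" "open S"
  shows "Ck_on k S f = Ck_on k S g"
  using Ck_on_local[of S k f] Ck_on_local[of S k g] assms by metis

lemma Ck_on_add: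
  assumes "open S" "Ck_on k S f" "Ck_on k S g"
  shows "Ck_on k S (\<lambda>x. f x + g x)"
  using assms
proof (induction k arbitrary: f g)
  case 0
  then show ?case by (simp add: continuous_on_add)
next
  case (Suc k)
  have "Ck_on k S (\<lambda>x. frechet_derivative (\<lambda>y. f y + g y) (at x) v)" for v
  proof -
    have "Ck_on k S (\<lambda>x. frechet_derivative f (at x) v + frechet_derivative g (at x) v)"
      using Suc by simp
    moreover have "frechet_derivative (\<lambda>y. f y + g y) (at x) v
        = frechet_derivative f (at x) v + frechet_derivative g (at x) v" if "x \<in> S" for x
    proof -
      have "((\<lambda>y. f y + g y) has_derivative
          (\<lambda>v. frechet_derivative f (at x) v + frechet_derivative g (at x) v)) (at x)"
        using Suc.prems that by (intro has_derivative_add) (auto simp: frechet_derivative_works)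
      from frechet_derivative_at[OF this] show ?thesis by metis
    qed
    ultimately show ?thesis by (subst Ck_on_cong[OF _ assms(1)])
  qed
  then show ?case using Suc.prems by (auto intro: differentiable_add)
qed

text \<open>As L squares to zero, 1 + L is the square of 1 + L/2, which has the inverse 1 - L/2;
  hence its determinant is a nonzero square.\<close>

lemma det_unipotent:
  fixes L :: "real^8 \<Rightarrow> real^8"
  assumes "linear L" "\<And>v. L (L v) = 0"
  shows "det (matrix (\<lambda>v. v + L v)) > 0"
proof -
  let ?M = "\<lambda>s. matrix (\<lambda>v. v + s *\<^sub>R L v)"
  have lin: "linear (\<lambda>v. v + s *\<^sub>R L v)" for s
    by (intro linear_compose_add linear_id[unfolded id_def] linear_compose_scale_right assms(1))
  have mult: "?M s ** ?M r = ?M (s + r)" for s r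
  proof -
    have "?M s ** ?M r = matrix ((\<lambda>v. v + s *\<^sub>R L v) \<circ> (\<lambda>v. v + r *\<^sub>R L v))"
      by (rule matrix_compose[symmetric, OF lin lin])
    also have "(\<lambda>v. v + s *\<^sub>R L v) \<circ> (\<lambda>v. v + r *\<^sub>R L v) = (\<lambda>v. v + (s + r) *\<^sub>R L v)"
      by (auto simp: linear_add[OF assms(1)] linear_scale[OF assms(1)] assms(2) algebra_simps)
    finally show ?thesis .
  qed
  have "?M 0 = mat 1" using matrix_id_mat_1 by (simp add: id_def)
  then have "det (?M (1/2)) * det (?M (-1/2)) = 1"
    using mult[of "1/2" "-1/2"] by (simp add: det_mul[symmetric])
  then have "det (?M (1/2)) \<noteq> 0" by auto
  moreover have "det (?M 1) = det (?M (1/2)) * det (?M (1/2))"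
    using mult[of "1/2" "1/2"] by (simp add: det_mul[symmetric])
  ultimately show ?thesis by (simp add: zero_less_mult_iff linorder_neq_iff disj_commute)
qed

section \<open>Nilmanifolds\<close>

definition lat :: "(real^8) set" where
  "lat = {n. \<forall>i. n $ i \<in> \<int>}"

lemma lat_zero: "0 \<in> lat"
  and lat_add: "m \<in> lat \<Longrightarrow> n \<in> lat \<Longrightarrow> m + n \<in> lat"
  and lat_minus: "n \<in> lat \<Longrightarrow> - n \<in> lat"
  and lat_diff: "m \<in> lat \<Longrightarrow> n \<in> lat \<Longrightarrow> m - n \<in> lat"
  by (auto simp: lat_def)

lemma closed_lat: "closed lat"
proof -
  have "lat = (\<Inter>i. (\<lambda>x. x $ i) -` \<int>)" by (auto simp: lat_def)
  moreover have "closed ((\<lambda>x::real^8. x $ i) -` \<int>)" for i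
    by (rule continuous_closed_vimage) (auto intro: closed_Ints continuous_intros)
  ultimately show ?thesis by (metis closed_INT)
qed

text \<open>
  A nilpotent group \<open>\<real>\<^sup>8\<close> whose commutators lie in the coordinate directions \<open>Z\<close>, which are central;
  integral vectors form a lattice in it.
\<close>

locale nil_lattice =
  fixes b :: "real^8 \<Rightarrow> real^8 \<Rightarrow> real^8" and Z :: "8 set"
  assumes b_bilinear: "bilinear b"
    and b_center: "i \<notin> Z \<Longrightarrow> b u v $ i = 0"
    and b_center_left: "(\<And>i. i \<notin> Z \<Longrightarrow> u $ i = 0) \<Longrightarrow> b u v = 0"
    and b_center_right: "(\<And>i. i \<notin> Z \<Longrightarrow> v $ i = 0) \<Longrightarrow> b u v = 0"
    and b_lat: "u \<in> lat \<Longrightarrow> v \<in> lat \<Longrightarrow> b u v \<in> lat"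
begin

sublocale b: bounded_bilinear b
  using b_bilinear by (simp add: bilinear_conv_bounded_bilinear)

lemma b_b_left: "b (b u v) w = 0"
  by (rule b_center_left) (rule b_center)

lemma b_b_right: "b u (b v w) = 0"
  by (rule b_center_right) (rule b_center)

lemmas b_simps = b.add_left b.add_right b.diff_left b.diff_right b.minus_left b.minus_right
  b.zero_left b.zero_right b_b_left b_b_right

text \<open>Left translation for the group law n * x = n + x - \<open>b n x\<close>. The minus sign
  is opposite to the sign in the coframe \<open>v + b x v\<close>, which makes the latter
  invariant.\<close>

definition shift :: "real^8 \<Rightarrow> real^8 \<Rightarrow> real^8" where
  "shift n x = x + n - b n x"

definition orb :: "real^8 \<Rightarrow> point" where
  "orb x = (\<lambda>n. shift n x) ` lat"

definition displ :: "real^8 \<Rightarrow> real^8 \<Rightarrow> real^8" where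
  "displ x y = y - x + b (y - x) x"

text \<open>
  If \<open>y\<close> lies in the orbit of \<open>x\<close>, then \<open>displ x y\<close> is the only candidate for the lattice element
  moving \<open>x\<close> to \<open>y\<close>; its continuity makes the orbit relation closed and the action
  properly discontinuous.
\<close>

lemma displ_shift: "displ x (shift n x) = n"
  by (simp add: displ_def shift_def b_simps)

lemma shift_displ: "shift (displ x y) x = y"
  by (simp add: displ_def shift_def b_simps)

lemma shift_zero: "shift 0 x = x"
  by (simp add: shift_def b_simps)

lemma act_shift: "shift m (shift n x) = shift (m + n - b m n) x"
  by (simp add: shift_def b_simps)

lemma shift_inverse: "shift (- n - b n n) (shift n x) = x"
  by (simp add: act_shift b_simps shift_zero)

lemma in_orb_iff: "y \<in> orb x \<longleftrightarrow> displ x y \<in> lat"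
  unfolding orb_def by (metis (no_types, lifting) shift_displ displ_shift image_iff)

lemma orb_shift: "n \<in> lat \<Longrightarrow> orb (shift n x) = orb x"
proof -
  have sub: "orb (shift n x) \<subseteq> orb x" if "n \<in> lat" for n x
    using that by (auto simp: orb_def act_shift intro!: imageI lat_add lat_diff b_lat)
  assume n: "n \<in> lat"
  then have "orb (shift (- n - b n n) (shift n x)) \<subseteq> orb (shift n x)"
    by (intro sub lat_diff lat_minus b_lat)
  then show ?thesis using sub[OF n] by (auto simp: shift_inverse)
qed

lemma orb_eq_iff: "orb x = orb y \<longleftrightarrow> displ x y \<in> lat"
proof
  assume "orb x = orb y"
  moreover have "y \<in> orb y" using lat_zero by (force simp: orb_def shift_zero)
  ultimately show "displ x y \<in> lat" by (simp add: in_orb_iff[symmetric])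
next
  assume "displ x y \<in> lat"
  then show "orb x = orb y" using orb_shift[of "displ x y" x] by (simp add: shift_displ)
qed

lemma continuous_on_b: "continuous_on S f \<Longrightarrow> continuous_on S g \<Longrightarrow> continuous_on S (\<lambda>x. b (f x) (g x))"
  by (rule b.continuous_on)

lemma continuous_shift: "continuous_on UNIV (shift n)"
  unfolding shift_def by (intro continuous_intros continuous_on_b)

definition quot :: "point topology" where
  "quot = topology (\<lambda>U. U \<subseteq> range orb \<and> open (orb -` U))"

lemma openin_quot: "openin quot U \<longleftrightarrow> U \<subseteq> range orb \<and> open (orb -` U)"
proof -
  have "istopology (\<lambda>U. U \<subseteq> range orb \<and> open (orb -` U))"
    unfolding istopology_def vimage_Int vimage_Union by (auto intro: open_Int)
  then show ?thesis unfolding quot_def by (simp add: topology_inverse')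
qed

lemma topspace_quot: "topspace quot = range orb"
proof -
  have "orb -` range orb = UNIV" by auto
  then have "openin quot (range orb)" by (simp add: openin_quot)
  then show ?thesis unfolding topspace_def openin_quot by blast
qed

lemma open_orb_image: "open U \<Longrightarrow> openin quot (orb ` U)"
proof -
  assume U: "open U"
  have "orb -` (orb ` U) = (\<Union>n\<in>lat. shift n -` U)"
  proof (intro set_eqI iffI)
    fix y assume "y \<in> orb -` (orb ` U)"
    then obtain x where x: "x \<in> U" "orb y = orb x" by auto
    then show "y \<in> (\<Union>n\<in>lat. shift n -` U)"
      using shift_displ[of y x] by (auto simp: orb_eq_iff intro!: bexI[of _ "displ y x"])
  next
    fix y assume "y \<in> (\<Union>n\<in>lat. shift n -` U)"
    then obtain n where "n \<in> lat" "shift n y \<in> U" by auto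
    then show "y \<in> orb -` (orb ` U)" using orb_shift[of n y] by (metis imageI vimageI)
  qed
  moreover have "open (shift n -` U)" for n
    using continuous_shift U by (simp add: continuous_on_open_vimage)
  ultimately show ?thesis by (auto simp: openin_quot)
qed

lemma continuous_orb: "continuous_map euclidean quot orb"
  by (auto simp: continuous_map_def topspace_quot openin_quot vimage_def)

text \<open>All local inverses of the projection \<open>orb\<close>. In such charts an invariant
  field has the same coordinate expression everywhere.\<close>

definition atlas :: "point chart set" where
  "atlas = {(orb ` U, inv_into U orb) |U. open U \<and> inj_on orb U}"

lemma in_atlasE:
  assumes "c \<in> atlas"
  obtains U where "c = (orb ` U, inv_into U orb)" "open U" "inj_on orb U" "chart_im c = U"
proof -
  from assms obtain U where "c = (orb ` U, inv_into U orb)" "open U" "inj_on orb U"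
    unfolding atlas_def by blast
  then show ?thesis by (intro that[of U]) (simp_all add: chart_im_def inv_into_image_cancel)
qed

text \<open>By continuity, \<open>displ\<close> has entries of absolute value below 1 near the
  diagonal point, and the only such lattice vector is 0. So \<open>orb\<close> is injective on a
  neighbourhood.\<close>

lemma ex_chart: "\<exists>c\<in>atlas. x \<in> chart_im c"
proof -
  let ?f = "\<lambda>p. displ (fst p) (snd p)"
  have cont: "continuous_on UNIV ?f"
    unfolding displ_def by (intro continuous_intros continuous_on_b)
  let ?N = "{n :: real^8. \<forall>i. \<bar>n $ i\<bar> < 1}"
  have "?N = (\<Inter>i. {n. \<bar>n $ i\<bar> < 1})" by auto
  moreover have "open {n :: real^8. \<bar>n $ i\<bar> < 1}" for i
    by (intro open_Collect_less continuous_intros)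
  ultimately have N: "open ?N" by (simp add: open_INT)
  have "open (?f -` ?N)" using N cont by (rule open_vimage)
  moreover have "(x, x) \<in> ?f -` ?N" by (simp add: displ_def b_simps)
  ultimately obtain A B where AB: "open A" "open B" "(x, x) \<in> A \<times> B" "A \<times> B \<subseteq> ?f -` ?N"
    by (rule open_prod_elim)
  let ?U = "A \<inter> B"
  have "inj_on orb ?U"
  proof (rule inj_onI)
    fix y z assume yz: "y \<in> ?U" "z \<in> ?U" "orb y = orb z"
    then have "displ y z \<in> lat" by (simp add: orb_eq_iff)
    moreover have "\<bar>displ y z $ i\<bar> < 1" for i using AB(4) yz by auto
    ultimately have "displ y z $ i = 0" for i
      unfolding lat_def using Ints_nonzero_abs_less1 by blast
    then have "displ y z = 0" by (simp add: vec_eq_iff)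
    then show "y = z" using shift_displ[of y z] by (simp add: shift_zero)
  qed
  then have "(orb ` ?U, inv_into ?U orb) \<in> atlas" using AB by (auto simp: atlas_def)
  moreover have "x \<in> chart_im (orb ` ?U, inv_into ?U orb)"
    using AB \<open>inj_on orb ?U\<close> by (simp add: chart_im_def inv_into_image_cancel)
  ultimately show ?thesis by blast
qed

lemma transition_domain:
  assumes "inj_on orb U"
  shows "inv_into U orb ` (orb ` U \<inter> orb ` V) = U \<inter> orb -` (orb ` V)"
proof -
  have "orb ` U \<inter> orb ` V = orb ` (U \<inter> orb -` (orb ` V))" by auto
  then show ?thesis using assms by (simp add: inv_into_image_cancel)
qed

lemma transition_eq:
  assumes "inj_on orb U" "x \<in> U"
  shows "transition (orb ` U, inv_into U orb) (orb ` V, inv_into V orb) x = inv_into V orb (orb x)"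
proof -
  have "bij_betw orb U (orb ` U)" using assms(1) by (simp add: bij_betw_def)
  from inv_into_inv_into_eq[OF this assms(2)] show ?thesis by (simp add: transition_def)
qed

text \<open>The lattice element taking x to its image y still takes nearby points into V, and
  injectivity of \<open>orb\<close> on V leaves no other value for the transition map.\<close>

lemma transition_local:
  assumes c: "c \<in> atlas" "c' \<in> atlas" and x: "x \<in> snd c ` (fst c \<inter> fst c')"
  obtains n W where "n \<in> lat" "open W" "x \<in> W" "\<And>y. y \<in> W \<Longrightarrow> transition c c' y = shift n y"
proof -
  obtain U where U: "c = (orb ` U, inv_into U orb)" "open U" "inj_on orb U"
    using c(1) by (rule in_atlasE)
  obtain V where V: "c' = (orb ` V, inv_into V orb)" "open V" "inj_on orb V"
    using c(2) by (rule in_atlasE)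
  have "x \<in> U \<inter> orb -` (orb ` V)"
    using x unfolding U(1) V(1) fst_conv snd_conv transition_domain[OF U(3)] .
  then obtain y where y: "x \<in> U" "y \<in> V" "orb x = orb y" by auto
  let ?n = "displ x y" and ?W = "U \<inter> shift (displ x y) -` V"
  have n: "?n \<in> lat" using y by (simp add: orb_eq_iff)
  show ?thesis
  proof (rule that[OF n])
    show "open ?W" using U(2) V(2) continuous_shift by (auto simp: continuous_on_open_vimage)
    show "x \<in> ?W" using y by (simp add: shift_displ)
    show "transition c c' z = shift ?n z" if "z \<in> ?W" for z
      using that V(3) n unfolding U(1) V(1)
      by (subst transition_eq) (auto simp: U(3) intro!: inv_into_f_eq orb_shift)
  qed
qed

lemma has_derivative_shift: "(shift n has_derivative (\<lambda>v. v - b n v)) (at x)"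
  unfolding shift_def
  by (auto intro!: derivative_eq_intros bounded_linear.has_derivative[OF b.bounded_linear_right])

lemma transition_derivative:
  assumes "c \<in> atlas" "c' \<in> atlas" "x \<in> snd c ` (fst c \<inter> fst c')"
  obtains n where "n \<in> lat" "transition c c' x = shift n x"
    "frechet_derivative (transition c c') (at x) = (\<lambda>v. v - b n v)"
proof -
  obtain n W where n: "n \<in> lat" "open W" "x \<in> W" "\<And>y. y \<in> W \<Longrightarrow> transition c c' y = shift n y"
    using transition_local[OF assms] by blast
  have "(transition c c' has_derivative (\<lambda>v. v - b n v)) (at x)"
    by (rule has_derivative_transform_within_open[OF has_derivative_shift n(2,3)]) (use n(4) in simp)
  then show ?thesis using n that by (metis frechet_derivative_at)
qed

lemma Hausdorff_quot: "Hausdorff_space quot"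
  unfolding Hausdorff_space_def
proof (intro allI impI)
  fix p q assume "p \<in> topspace quot \<and> q \<in> topspace quot \<and> p \<noteq> q"
  then obtain x y where xy: "p = orb x" "q = orb y" "orb x \<noteq> orb y"
    by (auto simp: topspace_quot)
  let ?f = "\<lambda>p. displ (fst p) (snd p)"
  have "continuous_on UNIV ?f"
    unfolding displ_def by (intro continuous_intros continuous_on_b)
  then have "open (?f -` (- lat))" using closed_lat by (simp add: continuous_on_open_vimage open_Compl)
  moreover have "(x, y) \<in> ?f -` (- lat)" using xy by (simp add: orb_eq_iff)
  ultimately obtain A B where AB: "open A" "open B" "(x, y) \<in> A \<times> B" "A \<times> B \<subseteq> ?f -` (- lat)"
    by (rule open_prod_elim)
  have "disjnt (orb ` A) (orb ` B)"
  proof (rule ccontr)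
    assume "\<not> disjnt (orb ` A) (orb ` B)"
    then obtain u v where uv: "u \<in> A" "v \<in> B" "orb u = orb v" unfolding disjnt_def by auto
    then have "displ u v \<in> lat" by (simp add: orb_eq_iff)
    then show False using AB(4) uv by auto
  qed
  then show "\<exists>U V. openin quot U \<and> openin quot V \<and> p \<in> U \<and> q \<in> V \<and> disjnt U V"
    using AB open_orb_image xy by blast
qed

lemma second_countable_quot:
  "\<exists>\<B>. countable \<B> \<and> (\<forall>V\<in>\<B>. openin quot V) \<and>
    (\<forall>U p. openin quot U \<and> p \<in> U \<longrightarrow> (\<exists>V\<in>\<B>. p \<in> V \<and> V \<subseteq> U))"
proof -
  obtain \<C> :: "(real^8) set set" where C: "countable \<C>" "topological_basis \<C>"
    using ex_countable_basis by blast
  have "\<exists>V\<in>(\<lambda>C. orb ` C) ` \<C>. p \<in> V \<and> V \<subseteq> U" if "openin quot U" "p \<in> U" for U p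
  proof -
    from that obtain x where x: "p = orb x" "open (orb -` U)" "x \<in> orb -` U"
      by (auto simp: openin_quot)
    then obtain C where "C \<in> \<C>" "x \<in> C" "C \<subseteq> orb -` U" using C(2) topological_basisE by metis
    then show ?thesis using x by blast
  qed
  then show ?thesis using C topological_basis_open[OF C(2)] open_orb_image
    by (intro exI[of _ "(\<lambda>C. orb ` C) ` \<C>"]) auto
qed

lemma connected_quot: "connected_space quot"
proof -
  have "connectedin quot (orb ` UNIV)"
    by (rule connectedin_continuous_map_image[OF continuous_orb]) (simp add: convex_connected)
  then show ?thesis using topspace_quot by (simp add: connectedin_topspace[symmetric])
qed

text \<open>The unit cube meets every orbit. The coordinates outside \<open>Z\<close> are reduced
  first, which disturbs those in \<open>Z\<close> through \<open>b\<close>; these are then reduced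
  by a central element, which acts as a plain translation and leaves the others alone.\<close>

lemma compact_quot: "compact_space quot"
proof -
  have "\<exists>y\<in>cbox 0 (\<chi> i. 1). orb x = orb y" for x
  proof -
    define n :: "real^8" where "n = (\<chi> i. if i \<in> Z then 0 else - of_int \<lfloor>x $ i\<rfloor>)"
    define x' where "x' = shift n x"
    define m :: "real^8" where "m = (\<chi> i. if i \<in> Z then - of_int \<lfloor>x' $ i\<rfloor> else 0)"
    have lat: "n \<in> lat" "m \<in> lat" by (auto simp: n_def m_def lat_def)
    have m: "shift m x' = x' + m" using b_center_left[of m x'] by (simp add: shift_def m_def)
    have "0 \<le> shift m x' $ i \<and> shift m x' $ i \<le> 1" for i
    proof (cases "i \<in> Z")
      case True
      then show ?thesis unfolding m by (simp add: m_def) linarith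
    next
      case False
      then have "shift m x' $ i = x $ i - of_int \<lfloor>x $ i\<rfloor>"
        unfolding m x'_def by (simp add: shift_def n_def m_def b_center)
      then show ?thesis by simp linarith
    qed
    then have "shift m x' \<in> cbox 0 (\<chi> i. 1)" by (simp add: mem_box_cart)
    moreover have "orb (shift m x') = orb x" using lat by (simp add: x'_def orb_shift)
    ultimately show ?thesis by metis
  qed
  then have "orb ` cbox 0 (\<chi> i. 1) = topspace quot" unfolding topspace_quot image_def by blast
  moreover have "compactin quot (orb ` cbox 0 (\<chi> i. 1))"
    by (rule image_compactin[OF _ continuous_orb]) (simp add: compactin_euclidean_iff)
  ultimately show ?thesis by (simp add: compact_space_def)
qed

lemma chart_homeomorphic:
  assumes "open U" "inj_on orb U"
  shows "homeomorphic_map (subtopology quot (orb ` U)) (top_of_set U) (inv_into U orb)"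
proof -
  have "homeomorphic_maps (top_of_set U) (subtopology quot (orb ` U)) orb (inv_into U orb)"
    unfolding homeomorphic_maps_def
  proof (intro conjI ballI)
    show "continuous_map (top_of_set U) (subtopology quot (orb ` U)) orb"
      using continuous_orb by (auto simp: continuous_map_in_subtopology continuous_map_from_subtopology)
    show "continuous_map (subtopology quot (orb ` U)) (top_of_set U) (inv_into U orb)"
      unfolding continuous_map_in_subtopology
    proof
      have top: "topspace (subtopology quot (orb ` U)) = orb ` U" by (auto simp: topspace_quot)
      show "inv_into U orb \<in> topspace (subtopology quot (orb ` U)) \<rightarrow> U"
        unfolding top by (auto intro: inv_into_into)
      show "continuous_map (subtopology quot (orb ` U)) euclidean (inv_into U orb)"
        unfolding continuous_map_def top
      proof (intro conjI allI impI)
        fix V :: "(real^8) set" assume "openin euclidean V"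
        then have "openin quot (orb ` (U \<inter> V))" using assms by (auto intro: open_orb_image)
        moreover have "{x \<in> orb ` U. inv_into U orb x \<in> V} = orb ` U \<inter> orb ` (U \<inter> V)"
          using assms(2) by (auto simp: inv_into_f_f)
        ultimately show "openin (subtopology quot (orb ` U)) {x \<in> orb ` U. inv_into U orb x \<in> V}"
          by (auto intro: openin_subtopology_Int2)
      qed simp
    qed
  qed (use assms in \<open>auto simp: topspace_quot f_inv_into_f inv_into_f_f\<close>)
  then show ?thesis by (simp add: homeomorphic_maps_map)
qed

lemma manifold_quot: "manifold8 quot atlas"
  unfolding manifold8_def
proof (intro conjI ballI)
  show "\<Union> (fst ` atlas) = topspace quot"
  proof
    show "\<Union> (fst ` atlas) \<subseteq> topspace quot" by (auto simp: topspace_quot atlas_def)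
    show "topspace quot \<subseteq> \<Union> (fst ` atlas)"
    proof
      fix p assume "p \<in> topspace quot"
      then obtain x where x: "p = orb x" by (auto simp: topspace_quot)
      obtain c where c: "c \<in> atlas" "x \<in> chart_im c" using ex_chart by blast
      then have "p \<in> fst c" using x by (auto elim!: in_atlasE)
      then show "p \<in> \<Union> (fst ` atlas)" using c by blast
    qed
  qed
  fix c assume c: "c \<in> atlas"
  then obtain U where U: "c = (orb ` U, inv_into U orb)" "open U" "inj_on orb U" "chart_im c = U"
    by (rule in_atlasE)
  show "openin quot (fst c)" "open (chart_im c)"
    "homeomorphic_map (subtopology quot (fst c)) (top_of_set (chart_im c)) (snd c)"
    using U by (simp_all add: open_orb_image chart_homeomorphic)
  fix c' assume c': "c' \<in> atlas"
  show "smooth_on (snd c ` (fst c \<inter> fst c')) (transition c c')"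
    unfolding smooth_on_def
  proof (intro allI Ck_on_local)
    fix k x assume "x \<in> snd c ` (fst c \<inter> fst c')"
    from transition_local[OF c c' this] obtain n W
      where "open W" "x \<in> W" "\<And>y. y \<in> W \<Longrightarrow> transition c c' y = shift n y" by metis
    then show "\<exists>W g. open W \<and> x \<in> W \<and> Ck_on k W g \<and> (\<forall>y\<in>W. transition c c' y = g y)"
      using Ck_on_constant_derivative[OF has_derivative_shift] by blast
  qed
qed (fact Hausdorff_quot connected_quot second_countable_quot)+

lemma oriented_quot: "oriented_atlas atlas"
  unfolding oriented_atlas_def
proof (intro ballI)
  fix c c' x assume c: "c \<in> atlas" "c' \<in> atlas" and x: "x \<in> snd c ` (fst c \<inter> fst c')"
  obtain n where "frechet_derivative (transition c c') (at x) = (\<lambda>v. v - b n v)"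
    by (rule transition_derivative[OF c x])
  moreover have "det (matrix (\<lambda>v. v + - b n v)) > 0"
    by (rule det_unipotent)
       (auto simp: b_simps linear_iff b.scaleR_right)
  ultimately show "det (matrix (frechet_derivative (transition c c') (at x))) > 0" by simp
qed

end

section \<open>Invariant structures\<close>

lemma multilinear_on_list_update:
  assumes "multilinear_on n t" "length vs = n" "i < n"
  shows "linear (\<lambda>v. t (vs[i := v]))"
  using multilinear_onD[OF assms(1), of "take i vs" "drop (Suc i) vs"] assms(2,3)
  by (simp add: upd_conv_take_nth_drop)

lemma dersum_map_add:
  assumes "multilinear_on (length vs) t"
  shows "dersum (\<lambda>v. A v + B v) t vs = dersum A t vs + dersum B t vs"
  unfolding dersum_conv_sum sum.distrib[symmetric]
  by (intro sum.cong refl linear_add multilinear_on_list_update[OF assms]) auto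

lemma dersum_map_scale:
  assumes "multilinear_on (length vs) t"
  shows "dersum (\<lambda>v. r *\<^sub>R A v) t vs = r * dersum A t vs"
  unfolding dersum_conv_sum sum_distrib_left
  using linear_scale[OF multilinear_on_list_update[OF assms refl]] by simp

lemma dersum_map_diff:
  assumes "multilinear_on (length vs) t"
  shows "dersum (\<lambda>v. A v - B v) t vs = dersum A t vs - dersum B t vs"
  using dersum_map_add[OF assms, of "\<lambda>v. A v - B v" B] by simp

lemma dersum_map_zero:
  assumes "multilinear_on (length vs) t"
  shows "dersum (\<lambda>v. 0) t vs = 0"
  using dersum_map_scale[OF assms, of 0 "\<lambda>v. 0"] by simp

lemma dersum_sum: "dersum A (\<lambda>us. \<Sum>i\<in>I. f i us) vs = (\<Sum>i\<in>I. dersum A (f i) vs)"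
  unfolding dersum_conv_sum by (rule sum.swap)

lemma dersum_Cons_expand:
  assumes "multilinear_on (Suc (length vs)) t"
  shows "dersum A (\<lambda>us. t (v # us)) vs = (\<Sum>i\<in>UNIV. v $ i * dersum A (\<lambda>us. t (axis i 1 # us)) vs)"
proof -
  have "dersum A (\<lambda>us. t (v # us)) vs = dersum A (\<lambda>us. \<Sum>i\<in>UNIV. v $ i * t (axis i 1 # us)) vs"
    by (rule dersum_cong) (rule multilinear_on_expand[OF assms])
  then show ?thesis by (simp add: dersum_sum dersum_scale)
qed

text \<open>Leibniz rule for a fixed tensor evaluated on moving vectors. Expanding the first slot in
  the standard basis reduces it to the product rule for real functions.\<close>

lemma has_derivative_multilinear:
  fixes E :: "real^8 \<Rightarrow> real^8 \<Rightarrow> real^8"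
  assumes "multilinear_on (length vs) t"
    and "\<And>v. ((\<lambda>y. E y v) has_derivative (\<lambda>h. A h (E x v))) (at x)"
  shows "((\<lambda>y. t (map (E y) vs)) has_derivative (\<lambda>h. dersum (A h) t (map (E x) vs))) (at x)"
  using assms(1)
proof (induction vs arbitrary: t)
  case Nil
  then show ?case by simp
next
  case (Cons v vs)
  have m: "multilinear_on (Suc (length (map (E y) vs))) t" for y using Cons.prems by simp
  have e: "t (map (E y) (v # vs)) = (\<Sum>i\<in>UNIV. E y v $ i * t (axis i 1 # map (E y) vs))" for y
    using multilinear_on_expand[OF m[of y] refl, of "E y v"] by simp
  have d: "((\<lambda>y. E y v $ i) has_derivative (\<lambda>h. A h (E x v) $ i)) (at x)" for i
    by (rule bounded_linear.has_derivative[OF bounded_linear_vec_nth assms(2)])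
  have "((\<lambda>y. t (map (E y) (v # vs))) has_derivative
      (\<lambda>h. \<Sum>i\<in>UNIV. E x v $ i * dersum (A h) (\<lambda>us. t (axis i 1 # us)) (map (E x) vs)
         + A h (E x v) $ i * t (axis i 1 # map (E x) vs))) (at x)"
    unfolding e
    by (intro has_derivative_sum has_derivative_mult d Cons.IH) (use Cons.prems in \<open>auto intro: multilinear_on_Cons\<close>)
  moreover have "(\<Sum>i\<in>UNIV. E x v $ i * dersum (A h) (\<lambda>us. t (axis i 1 # us)) (map (E x) vs)
         + A h (E x v) $ i * t (axis i 1 # map (E x) vs))
      = dersum (A h) t (map (E x) (v # vs))" for h
    using multilinear_on_expand[OF m[of x] refl, of "A h (E x v)"]
      dersum_Cons_expand[OF m[of x], of "A h" "E x v"] by (simp add: sum.distrib)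
  ultimately show ?case by simp
qed

lemma multilinear_on_map:
  assumes "multilinear_on k t" "linear L"
  shows "multilinear_on k (\<lambda>vs. t (map L vs))"
proof (rule multilinear_onI)
  fix us ws :: "(real^8) list"
  assume "length us + 1 + length ws = k"
  then have "linear (\<lambda>v. t (map L us @ v # map L ws))"
    by (intro multilinear_onD[OF assms(1)]) simp
  from linear_compose[OF assms(2) this] show "linear (\<lambda>v. t (map L (us @ v # ws)))"
    by (simp add: o_def)
qed

lemma alt_forms_map: "t \<in> alt_forms k \<Longrightarrow> linear L \<Longrightarrow> (\<lambda>vs. t (map L vs)) \<in> alt_forms k"
  unfolding alt_forms_def alternating_on_def by (auto intro: multilinear_on_map simp: distinct_map)

lemma multilinear_on_append: "multilinear_on (length us + n) t \<Longrightarrow> multilinear_on n (\<lambda>ws. t (us @ ws))"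
proof (induction us arbitrary: t)
  case (Cons u us)
  have "multilinear_on (length us + n) (\<lambda>ws. t (u # ws))"
    by (rule multilinear_on_Cons) (use Cons.prems in simp)
  from Cons.IH[OF this] show ?case by simp
qed simp

lemma multilinear_on_sum:
  assumes "finite S" "\<And>i. i \<in> S \<Longrightarrow> multilinear_on n (f i)"
  shows "multilinear_on n (\<lambda>vs. \<Sum>i\<in>S. f i vs)"
  using assms
proof (induction S rule: finite_induct)
  case empty
  then show ?case by (simp add: multilinear_on_def linear_iff)
qed (simp add: multilinear_on_add)

lemma finite_lists_8: "finite {I :: 8 list. length I = k}"
  using finite_lists_length_eq[of "UNIV :: 8 set" k] by simp

lemma multilinear_on_star0:
  assumes "k \<le> 8"
  shows "multilinear_on (8 - k) (star0 k t)"
proof -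
  have e: "star0 k t = (\<lambda>ws. \<Sum>I\<in>{I. length I = k}. (t (map basis_vec I) / fact k) * vdet (map basis_vec I @ ws))"
    by (rule ext) (simp add: star0_def sum_divide_distrib)
  have "multilinear_on (8 - k) (\<lambda>ws. vdet (map basis_vec I @ ws))" if "length I = k" for I :: "8 list"
    using multilinear_on_vdet assms that by (intro multilinear_on_append) simp
  then show ?thesis unfolding e
    by (intro multilinear_on_sum multilinear_on_scale finite_lists_8) auto
qed

text \<open>The vectors E ei and adjoint F ei form dual bases, and a contraction over dual bases
  does not depend on their choice.\<close>

lemma contraction_invariant:
  fixes E F :: "real^8 \<Rightarrow> real^8"
  assumes EF: "linear E" "linear F" "\<And>v. E (F v) = v"
    and fg: "linear f" "linear (g :: real^8 \<Rightarrow> real)"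
  shows "(\<Sum>i\<in>UNIV. f (adjoint F (axis i 1)) * g (E (axis i 1))) = (\<Sum>i\<in>UNIV. f (axis i 1) * g (axis i 1))"
proof -
  have n: "adjoint F (axis i 1) $ j = F (axis j 1) $ i" for i j
    using adjoint_works[OF EF(2), of "axis j 1" "axis i 1"] by (simp add: inner_axis inner_axis')
  have "(\<Sum>i\<in>UNIV. f (adjoint F (axis i 1)) * g (E (axis i 1)))
      = (\<Sum>i\<in>UNIV. \<Sum>j\<in>UNIV. F (axis j 1) $ i * f (axis j 1) * g (E (axis i 1)))"
    using linear_expand[OF fg(1), of "adjoint F (axis i 1)" for i] by (simp add: n sum_distrib_right)
  also have "\<dots> = (\<Sum>j\<in>UNIV. f (axis j 1) * (\<Sum>i\<in>UNIV. F (axis j 1) $ i * g (E (axis i 1))))"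
    by (subst sum.swap) (simp add: sum_distrib_left mult_ac)
  also have "\<dots> = (\<Sum>j\<in>UNIV. f (axis j 1) * g (E (F (axis j 1))))"
    using linear_expand[OF linear_compose[OF EF(1) fg(2)], of "F (axis j 1)" for j] by (simp add: o_def)
  finally show ?thesis by (simp add: EF(3))
qed

lemma contraction_invariant_list:
  fixes E F :: "real^8 \<Rightarrow> real^8"
  assumes EF: "linear E" "linear F" "\<And>v. E (F v) = v"
    and "multilinear_on k s" "multilinear_on k t"
  shows "(\<Sum>I\<in>{I. length I = k}. s (map (\<lambda>i. adjoint F (axis i 1)) I) * t (map (\<lambda>i. E (axis i 1)) I))
    = (\<Sum>I\<in>{I. length I = k}. s (map basis_vec I) * t (map basis_vec I))"
  using assms(4,5)
proof (induction k arbitrary: s t)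
  case 0
  have "{I :: 8 list. length I = 0} = {[]}" by auto
  then show ?case by simp
next
  case (Suc k)
  let ?M = "{I :: 8 list. length I = k}"
  let ?G = "\<lambda>i. adjoint F (axis i 1)" and ?E = "\<lambda>i. E (axis i 1)"
  have "(\<Sum>i\<in>UNIV. \<Sum>I\<in>?M. s (?G i # map ?G I) * t (?E i # map ?E I))
      = (\<Sum>I\<in>?M. \<Sum>i\<in>UNIV. s (?G i # map ?G I) * t (?E i # map ?E I))"
    by (rule sum.swap)
  also have "\<dots> = (\<Sum>I\<in>?M. \<Sum>i\<in>UNIV. s (axis i 1 # map ?G I) * t (axis i 1 # map ?E I))"
  proof (rule sum.cong[OF refl])
    fix I :: "8 list" assume "I \<in> ?M"
    then have "linear (\<lambda>v. s (v # map ?G I))" "linear (\<lambda>v. t (v # map ?E I))"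
      using Suc.prems by (simp_all add: multilinear_on_hd)
    from contraction_invariant[OF EF this]
    show "(\<Sum>i\<in>UNIV. s (?G i # map ?G I) * t (?E i # map ?E I))
        = (\<Sum>i\<in>UNIV. s (axis i 1 # map ?G I) * t (axis i 1 # map ?E I))" .
  qed
  also have "\<dots> = (\<Sum>i\<in>UNIV. \<Sum>I\<in>?M. s (axis i 1 # map ?G I) * t (axis i 1 # map ?E I))"
    by (rule sum.swap)
  also have "\<dots> = (\<Sum>i\<in>UNIV. \<Sum>I\<in>?M. s (axis i 1 # map basis_vec I) * t (axis i 1 # map basis_vec I))"
    by (intro sum.cong refl Suc.IH multilinear_on_Cons Suc.prems)
  finally show ?case unfolding sum_lists_Suc by simp
qed

lemma vdet_map:
  assumes "linear L" "length vs = 8"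
  shows "vdet (map L vs) = det (matrix L) * vdet vs"
proof -
  have "(vector (map L vs) :: real^8^8) = vector vs ** transpose (matrix L)"
  proof (simp only: vec_eq_iff, intro allI)
    fix i j
    have "L (vs ! ix i) $ j = (matrix L *v (vs ! ix i)) $ j"
      using fun_cong[OF matrix_vector_mul(2)[OF assms(1)], of "vs ! ix i"] by simp
    then show "(vector (map L vs) :: real^8^8) $ i $ j = (vector vs ** transpose (matrix L)) $ i $ j"
      using assms(2) ix_less[of i]
      by (simp add: vector_nth_8 matrix_matrix_mult_def matrix_vector_mult_def transpose_def mult.commute)
  qed
  then show ?thesis by (simp add: vdet_def det_mul det_transpose)
qed

lemma trace_invariant:
  fixes E F R :: "real^8 \<Rightarrow> real^8"
  assumes "linear E" "linear F" "linear R" "\<And>v. E (F v) = v"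
  shows "(\<Sum>i\<in>UNIV. F (R (E (axis i 1))) $ i) = (\<Sum>i\<in>UNIV. R (axis i 1) $ i)"
proof -
  have tr: "(\<Sum>i\<in>UNIV. L (axis i 1) $ i) = trace (matrix L)" for L :: "real^8 \<Rightarrow> real^8"
    by (simp add: trace_def matrix_def)
  have "trace (matrix (F \<circ> (R \<circ> E))) = trace (matrix F ** matrix (R \<circ> E))"
    using assms by (simp add: matrix_compose linear_compose)
  also have "\<dots> = trace (matrix (R \<circ> E) ** matrix F)" by (rule trace_mul_sym)
  also have "\<dots> = trace (matrix ((R \<circ> E) \<circ> F))"
    using assms by (simp add: matrix_compose linear_compose)
  also have "(R \<circ> E) \<circ> F = R" using assms(4) by auto
  finally show ?thesis by (simp add: tr[symmetric])
qed

lemma Ck_on_sum: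
  assumes "open S" "\<And>i. i < (n::nat) \<Longrightarrow> Ck_on k S (f i)"
  shows "Ck_on k S (\<lambda>x. \<Sum>i<n. f i x)"
  using assms(2) by (induction n) (simp_all add: Ck_on_const Ck_on_add[OF assms(1)])

text \<open>
  The invariant coframe is \<open>E x v = P (v + b x v)\<close>, with \<open>P\<close> adapting the lattice to the normal form
  of the structure. It satisfies \<open>\<partial>\<^sub>h (E v) = c (E h) (E v)\<close>, and \<open>C\<close> is the Levi-Civita
  connection in terms of it: \<open>E (\<nabla>\<^sub>u v) = C (E u) (E v)\<close> for constant vector fields \<open>u\<close>, \<open>v\<close>.
\<close>

locale nil_coframe = nil_lattice +
  fixes P Q :: "real^8 \<Rightarrow> real^8" and c C :: "real^8 \<Rightarrow> real^8 \<Rightarrow> real^8"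
  assumes P_linear: "linear P" and Q_linear: "linear Q"
    and P_Q: "P (Q v) = v" and Q_P: "Q (P v) = v"
    and det_P: "det (matrix P) > 0"
    and c_P: "c (P u) (P v) = P (b u v)"
    and koszul: "2 * (C u v \<bullet> w) = c u v \<bullet> w + v \<bullet> c u w + c v u \<bullet> w + u \<bullet> c v w - c w u \<bullet> v - u \<bullet> c w v"
begin

lemma c_eq: "c u v = P (b (Q u) (Q v))"
  using c_P[of "Q u" "Q v"] by (simp add: P_Q)

sublocale c: bounded_bilinear c
proof -
  have "bilinear c"
    unfolding bilinear_def linear_iff c_eq
    by (simp add: linear_add[OF Q_linear] linear_scale[OF Q_linear] b_simps b.scaleR_left b.scaleR_right
        linear_add[OF P_linear] linear_scale[OF P_linear])
  then show "bounded_bilinear c" by (simp add: bilinear_conv_bounded_bilinear)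
qed

sublocale C: bounded_bilinear C
proof -
  have C: "C u v \<bullet> w = (c u v \<bullet> w + v \<bullet> c u w + c v u \<bullet> w + u \<bullet> c v w - c w u \<bullet> v - u \<bullet> c w v) / 2" for u v w
    using koszul[of u v w] by simp
  have "bilinear C"
    unfolding bilinear_def linear_iff
    by (intro conjI allI; subst vector_eq_rdot[symmetric])
       (simp_all add: C inner_add_left inner_add_right c.add_left c.add_right c.scaleR_left c.scaleR_right
          add_divide_distrib diff_divide_distrib distrib_left right_diff_distrib)
  then show "bounded_bilinear C" by (simp add: bilinear_conv_bounded_bilinear)
qed

definition E :: "real^8 \<Rightarrow> real^8 \<Rightarrow> real^8" where
  "E x v = P (v + b x v)"

definition F :: "real^8 \<Rightarrow> real^8 \<Rightarrow> real^8" where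
  "F x v = Q v - b x (Q v)"

lemma E_F: "E x (F x v) = v"
  by (simp add: E_def F_def b_simps P_Q)

lemma F_E: "F x (E x v) = v"
  by (simp add: E_def F_def b_simps Q_P)

lemma E_linear: "linear (E x)"
  unfolding linear_iff E_def
  by (simp add: b_simps b.scaleR_right linear_add[OF P_linear] linear_scale[OF P_linear] scaleR_right_distrib)

lemma F_linear: "linear (F x)"
  unfolding linear_iff F_def
  by (simp add: b_simps b.scaleR_right linear_add[OF Q_linear] linear_scale[OF Q_linear] scaleR_right_diff_distrib)

lemma c_E: "c (E x u) (E x v) = E x (b u v)"
  by (simp add: E_def c_P b_simps)

lemma E_shift: "E (shift n x) (v - b n v) = E x v"
  by (simp add: E_def shift_def b_simps)

lemma E_has_derivative: "((\<lambda>y. E y v) has_derivative (\<lambda>h. c (E x h) (E x v))) (at x)"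
proof -
  have P: "bounded_linear P" using P_linear by (simp add: linear_conv_bounded_linear)
  have "((\<lambda>y. v + b y v) has_derivative (\<lambda>h. 0 + b h v)) (at x)"
    by (rule has_derivative_add[OF has_derivative_const
          bounded_linear_imp_has_derivative[OF b.bounded_linear_left]])
  from bounded_linear.has_derivative[OF P this]
  have "((\<lambda>y. P (v + b y v)) has_derivative (\<lambda>h. P (0 + b h v))) (at x)" .
  moreover have "c (E x h) (E x v) = P (0 + b h v)" for h
    unfolding c_E by (simp add: E_def b_simps)
  ultimately show ?thesis by (simp add: E_def[abs_def])
qed

lemma matrix_E_has_derivative: "((\<lambda>x. matrix (E x)) has_derivative (\<lambda>h. matrix (\<lambda>v. P (b h v)))) (at x)"
proof -
  have m: "matrix (E x) = matrix P + matrix (\<lambda>v. P (b x v))" for x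
    by (simp add: matrix_def vec_eq_iff E_def linear_add[OF P_linear])
  have "linear (\<lambda>x. matrix (\<lambda>v. P (b x v)))"
    unfolding linear_iff
    by (simp add: matrix_def vec_eq_iff b_simps b.scaleR_left linear_add[OF P_linear] linear_scale[OF P_linear])
  then have "bounded_linear (\<lambda>x. matrix (\<lambda>v. P (b x v)))" by (simp add: linear_conv_bounded_linear)
  then have "((\<lambda>x. matrix P + matrix (\<lambda>v. P (b x v))) has_derivative (\<lambda>h. 0 + matrix (\<lambda>v. P (b h v)))) (at x)"
    by (intro has_derivative_add has_derivative_const bounded_linear_imp_has_derivative)
  then show ?thesis by (simp add: m[abs_def])
qed

lemma det_E: "det (matrix (E x)) > 0"
proof -
  have "linear (\<lambda>v. v + b x v)"
    unfolding linear_iff by (simp add: b_simps b.scaleR_right scaleR_right_distrib)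
  then have "matrix (E x) = matrix P ** matrix (\<lambda>v. v + b x v)"
    using matrix_compose[of "\<lambda>v. v + b x v" P] P_linear by (simp add: E_def[abs_def] o_def)
  moreover have "det (matrix (\<lambda>v. v + b x v)) > 0"
    by (rule det_unipotent) (auto simp: b_simps linear_iff b.scaleR_right)
  ultimately show ?thesis using det_P by (simp add: det_mul)
qed

text \<open>The tensor with constant coefficients t in the invariant coframe. One formula serves all
  charts, since \<open>E_shift\<close> makes it compatible with every chart change.\<close>

definition fld :: "tensor \<Rightarrow> point chart \<Rightarrow> local_field" where
  "fld t k x vs = t (map (E x) vs)"

lemma fld_has_derivative:
  assumes "multilinear_on (length vs) t"
  shows "((\<lambda>y. fld t k y vs) has_derivative (\<lambda>h. dersum (c (E x h)) t (map (E x) vs))) (at x)"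
  unfolding fld_def
  by (rule has_derivative_multilinear[where A = "\<lambda>h. c (E x h)", OF assms E_has_derivative])

lemma fld_frechet:
  assumes "multilinear_on (length vs) t"
  shows "frechet_derivative (\<lambda>y. fld t k y vs) (at x) h = dersum (c (E x h)) t (map (E x) vs)"
  using frechet_derivative_at[OF fld_has_derivative[OF assms]] by metis

text \<open>By \<open>c_E\<close>, a directional derivative is a finite sum of values of the same
  field with one argument replaced by its image under \<open>b h\<close>. The family is thus closed
  under differentiation.\<close>

lemma fld_smooth:
  assumes "open S" "multilinear_on (length vs) t"
  shows "smooth_on S (\<lambda>x. fld t k x vs)"
proof -
  have "Ck_on m S (\<lambda>x. fld t k x us)" if "length us = length vs" for m us
    using that
  proof (induction m arbitrary: us)
    case 0
    have "multilinear_on (length us) t" using assms(2) 0 by simp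
    from has_derivative_continuous[OF fld_has_derivative[OF this, of k]] show ?case
      by (auto intro: continuous_at_imp_continuous_on)
  next
    case (Suc m)
    have m: "multilinear_on (length us) t" using assms(2) Suc.prems by simp
    have "frechet_derivative (\<lambda>y. fld t k y us) (at x) h
        = (\<Sum>i<length us. fld t k x (us[i := b h (us ! i)]))" for x h
      unfolding fld_frechet[OF m] dersum_conv_sum by (simp add: fld_def map_update c_E)
    moreover have "Ck_on m S (\<lambda>x. \<Sum>i<length us. fld t k x (us[i := b h (us ! i)]))" for h
      using Suc by (intro Ck_on_sum assms) simp
    ultimately show ?case using differentiableI[OF fld_has_derivative[OF m, of k]] by simp
  qed
  then show ?thesis by (simp add: smooth_on_def)
qed

lemma tensor_field_fld:
  assumes "multilinear_on m t"
  shows "tensor_field atlas m (fld t)"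
  unfolding tensor_field_def
proof (intro conjI ballI allI impI)
  fix k x assume "k \<in> atlas"
  show "multilinear_on m (fld t k x)"
    unfolding fld_def[abs_def] by (rule multilinear_on_map[OF assms E_linear])
next
  fix k and vs :: "(real^8) list" assume "k \<in> atlas" "length vs = m"
  then show "smooth_on (chart_im k) (\<lambda>x. fld t k x vs)"
    using assms by (intro fld_smooth) (auto elim: in_atlasE)
next
  fix k k' p and vs :: "(real^8) list"
  assume k: "k \<in> atlas" "k' \<in> atlas" and p: "p \<in> fst k \<inter> fst k'"
  then have x: "snd k p \<in> snd k ` (fst k \<inter> fst k')" by blast
  obtain n where n: "n \<in> lat"
    "transition k k' (snd k p) = shift n (snd k p)"
    "frechet_derivative (transition k k') (at (snd k p)) = (\<lambda>v. v - b n v)"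
    by (rule transition_derivative[OF k x])
  obtain U where U: "k = (orb ` U, inv_into U orb)" "inj_on orb U"
    using k(1) by (rule in_atlasE)
  have "inv_into (fst k) (snd k) (snd k p) = p"
    using p U by (intro inv_into_f_f) (auto intro: inj_on_inv_into)
  then have "snd k' p = shift n (snd k p)" using n(2) by (simp add: transition_def)
  then show "fld t k (snd k p) vs
      = fld t k' (snd k' p) (map (frechet_derivative (transition k k') (at (snd k p))) vs)"
    by (simp add: fld_def n(3) o_def E_shift)
qed

lemma diff_form_fld: "t \<in> alt_forms m \<Longrightarrow> diff_form atlas m (fld t)"
  unfolding diff_form_def fld_def[abs_def]
  using tensor_field_fld alt_forms_map[OF _ E_linear] by (auto simp: alt_forms_def fld_def[abs_def])

definition g0 :: tensor where
  "g0 vs = vs ! 0 \<bullet> vs ! 1"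

lemma multilinear_on_g0: "multilinear_on 2 g0"
proof (rule multilinear_onI)
  fix us ws :: "(real^8) list"
  assume "length us + 1 + length ws = 2"
  then have "(us = [] \<and> length ws = 1) \<or> (length us = 1 \<and> ws = [])" by (cases us; cases ws) auto
  then show "linear (\<lambda>v. g0 (us @ v # ws))"
    by (auto simp: g0_def length_Suc_conv linear_iff inner_add_left inner_add_right)
qed

abbreviation g :: "point chart \<Rightarrow> local_field" where "g \<equiv> fld g0"

lemma g_eq: "g k x [u, v] = E x u \<bullet> E x v"
  by (simp add: fld_def g0_def)

lemma E_eq_0: "E x v = 0 \<longleftrightarrow> v = 0"
  using F_E[of x v] linear_0[OF F_linear] linear_0[OF E_linear] by metis

lemma riemannian_g: "riemannian_metric atlas g"
  unfolding riemannian_metric_def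
  using tensor_field_fld[OF multilinear_on_g0] by (auto simp: g_eq inner_commute E_eq_0)

lemma sharp_g:
  assumes "\<And>w. A \<bullet> E x w = \<alpha> w"
  shows "sharp (g k x) \<alpha> = F x A"
  unfolding sharp_def g_eq
proof (rule the_equality)
  show "\<forall>w. E x (F x A) \<bullet> E x w = \<alpha> w" using assms by (simp add: E_F)
  fix z assume z: "\<forall>w. E x z \<bullet> E x w = \<alpha> w"
  have "E x z \<bullet> y = A \<bullet> y" for y
    using z assms by (metis E_F)
  then have "E x z = A" using vector_eq_rdot by blast
  then show "z = F x A" using F_E by metis
qed

text \<open>The Gram matrix of the metric is the transpose of E times E, so its inverse is F times
  the transpose of F.\<close>

lemma raised_vec_g: "raised_vec (g k x) i = F x (adjoint (F x) (axis i 1))"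
  unfolding raised_vec_def
proof (rule sharp_g)
  fix w
  have "adjoint (F x) (axis i 1) \<bullet> E x w = F x (E x w) \<bullet> axis i 1"
    using adjoint_works[OF F_linear] by (simp add: inner_commute)
  then show "adjoint (F x) (axis i 1) \<bullet> E x w = w $ i" by (simp add: F_E inner_axis)
qed

text \<open>The square root of the Gram determinant is det E without a sign, because
  \<open>det_E\<close> is positive.\<close>

lemma vol_form_g:
  assumes "length vs = 8"
  shows "vol_form (g k x) vs = vdet (map (E x) vs)"
proof -
  let ?M = "matrix (E x)"
  have "(\<chi> i j. g k x [basis_vec i, basis_vec j]) = transpose ?M ** ?M"
    by (simp add: g_eq vec_eq_iff matrix_matrix_mult_def transpose_def matrix_def inner_vec_def)
  then have "sqrt (det (\<chi> i j. g k x [basis_vec i, basis_vec j])) = det ?M"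
    using det_E[of x] by (simp add: det_mul det_transpose real_sqrt_mult_self)
  then show ?thesis unfolding vol_form_def vdet_map[OF E_linear assms] by (simp add: vdet_def)
qed

text \<open>The star contracts raised coordinate indices with lowered ones. In the coframe these
  become the dual bases of \<open>contraction_invariant_list\<close>, which may be replaced by the
  standard basis.\<close>

lemma hodge_star_fld:
  assumes "multilinear_on m t" "m + length ws = 8"
  shows "hodge_star m (g k x) (fld t k x) ws = star0 m t (map (E x) ws)"
proof -
  let ?G = "\<lambda>i. adjoint (F x) (axis i 1)"
  have "fld t k x (map (raised_vec (g k x)) I) = t (map ?G I)" for I
    by (simp add: fld_def raised_vec_g E_F o_def)
  moreover have "vol_form (g k x) (map basis_vec I @ ws) = vdet (map (\<lambda>i. E x (axis i 1)) I @ map (E x) ws)"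
    if "length I = m" for I
    using assms(2) that by (subst vol_form_g) (auto simp: o_def)
  ultimately have "hodge_star m (g k x) (fld t k x) ws = (\<Sum>I\<in>{I. length I = m}.
      t (map ?G I) * vdet (map (\<lambda>i. E x (axis i 1)) I @ map (E x) ws)) / fact m"
    by (simp add: hodge_star_def)
  also have "(\<Sum>I\<in>{I. length I = m}. t (map ?G I) * vdet (map (\<lambda>i. E x (axis i 1)) I @ map (E x) ws))
      = (\<Sum>I\<in>{I. length I = m}. t (map basis_vec I) * vdet (map basis_vec I @ map (E x) ws))"
  proof (rule contraction_invariant_list[OF E_linear F_linear E_F assms(1)])
    show "multilinear_on m (\<lambda>us. vdet (us @ map (E x) ws))"
    proof (rule multilinear_onI)
      fix us vs :: "(real^8) list" assume "length us + 1 + length vs = m"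
      then show "linear (\<lambda>v. vdet ((us @ v # vs) @ map (E x) ws))"
        using multilinear_onD[OF multilinear_on_vdet, of us "vs @ map (E x) ws"] assms(2) by simp
    qed
  qed
  finally show ?thesis by (simp add: star0_def)
qed

lemma ext_deriv_fld:
  assumes "multilinear_on m t" "length vs = Suc m"
  shows "ext_deriv (fld t k) x vs = dext c t (map (E x) vs)"
proof -
  have "length (omit i vs) = m" if "i < length vs" for i
    using that assms(2) by (simp add: omit_def)
  then have "ext_deriv (fld t k) x vs
      = (\<Sum>i<length vs. (-1)^i * dersum (c (E x (vs ! i))) t (map (E x) (omit i vs)))"
    unfolding ext_deriv_def using assms(1) by (intro sum.cong refl) (simp add: fld_frechet)
  then show ?thesis
    unfolding dext_def asum_map by (simp add: asum_conv_sum)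
qed

lemma closed_fld:
  assumes "multilinear_on m t" "\<And>vs. length vs = Suc m \<Longrightarrow> dext c t vs = 0"
  shows "closed_form atlas m (fld t)"
  unfolding closed_form_def by (simp add: ext_deriv_fld[OF assms(1)] assms(2))

lemma harmonic_fld:
  assumes t: "multilinear_on m t" "m \<le> 8"
    and d: "\<And>vs. length vs = Suc m \<Longrightarrow> dext c t vs = 0"
    and ds: "\<And>vs. length vs = Suc (8 - m) \<Longrightarrow> dext c (star0 m t) vs = 0"
  shows "harmonic atlas g m (fld t)"
proof -
  have "ext_deriv (\<lambda>y. hodge_star m (g k y) (fld t k y)) x vs = ext_deriv (fld (star0 m t) k) x vs"
    if "length vs = Suc (8 - m)" for k x vs
  proof -
    have "hodge_star m (g k y) (fld t k y) (omit i vs) = fld (star0 m t) k y (omit i vs)"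
      if "i < length vs" for i y
      unfolding fld_def[of "star0 m t"]
      by (rule hodge_star_fld[OF t(1)]) (use that t(2) \<open>length vs = _\<close> in \<open>simp add: omit_def\<close>)
    then show ?thesis unfolding ext_deriv_def by simp
  qed
  then have "coclosed_form atlas g m (fld t)"
    unfolding coclosed_form_def
    using closed_fld[OF multilinear_on_star0[OF t(2)] ds] by (simp add: closed_form_def)
  then show ?thesis using closed_fld[OF t(1) d] by (simp add: harmonic_def)
qed

lemma adapted_fld:
  assumes "open W"
  shows "adapted_coframe m t (fld t k) (g k) W (\<lambda>x. matrix (E x))"
proof -
  have "(*v) (matrix (E x)) = E x" for x by (rule matrix_vector_mul(2)[OF E_linear])
  moreover have "invertible (matrix (E x))" for x
    using det_E[of x] by (simp add: invertible_det_nz)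
  ultimately show ?thesis
    using Ck_on_constant_derivative[OF matrix_E_has_derivative]
    by (simp add: adapted_coframe_def smooth_on_def fld_def g0_def)
qed

lemma PSU3_fld:
  assumes "rho0 \<in> alt_forms 3"
  shows "PSU3_structure atlas (fld rho0) g"
  unfolding PSU3_structure_def
proof (intro conjI ballI)
  fix k x assume k: "k \<in> atlas" "x \<in> chart_im k"
  then have "open (chart_im k)" by (auto elim: in_atlasE)
  then show "\<exists>W E. open W \<and> x \<in> W \<and> W \<subseteq> chart_im k \<and>
      adapted_coframe 3 rho0 (fld rho0 k) (g k) W E \<and> (\<forall>y\<in>W. det (E y) > 0)"
    using k(2) adapted_fld det_E by blast
qed (simp_all add: oriented_quot diff_form_fld assms riemannian_g)

lemma Sp1Sp2_fld:
  assumes "Omega0 \<in> alt_forms 4"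
  shows "Sp1Sp2_structure atlas (fld Omega0) g"
  unfolding Sp1Sp2_structure_def
proof (intro conjI ballI)
  fix k x assume k: "k \<in> atlas" "x \<in> chart_im k"
  then have "open (chart_im k)" by (auto elim: in_atlasE)
  then show "\<exists>W E. open W \<and> x \<in> W \<and> W \<subseteq> chart_im k \<and>
      adapted_coframe 4 Omega0 (fld Omega0 k) (g k) W E"
    using k(2) adapted_fld by blast
qed (simp_all add: diff_form_fld assms riemannian_g)

text \<open>The derivative of g(v, w) along u is that of the inner product of E v and E w, in which
  each factor is differentiated by \<open>c (E x u)\<close>; with this, the assumption
  \<open>koszul\<close> is Koszul's formula in the coframe.\<close>

lemma christoffel_g: "christoffel (g k) x u v = F x (C (E x u) (E x v))"
  unfolding christoffel_def
proof (rule sharp_g)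
  fix w
  have d: "frechet_derivative (\<lambda>y. g k y [v, w]) (at x) u
      = c (E x u) (E x v) \<bullet> E x w + E x v \<bullet> c (E x u) (E x w)" for u v w
    using fld_frechet[of "[v, w]" g0] multilinear_on_g0 by (simp add: g0_def numeral_2_eq_2)
  show "C (E x u) (E x v) \<bullet> E x w = (frechet_derivative (\<lambda>y. g k y [v, w]) (at x) u
      + frechet_derivative (\<lambda>y. g k y [u, w]) (at x) v
      - frechet_derivative (\<lambda>y. g k y [u, v]) (at x) w) / 2"
    unfolding d using koszul[of "E x u" "E x v" "E x w"] by simp
qed

text \<open>Differentiating a field with constant coefficients produces the derivation
  \<open>c\<close>, and the Christoffel correction subtracts \<open>C\<close>. So \<open>om\<close>
  is what the Levi-Civita derivative does to such a field; \<open>om_skew\<close> expresses that the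
  metric is parallel.\<close>

definition om :: "real^8 \<Rightarrow> real^8 \<Rightarrow> real^8" where
  "om u v = c u v - C u v"

lemma om_skew: "om u v \<bullet> w = - (om u w \<bullet> v)"
  using koszul[of u v w] koszul[of u w v] inner_commute[of w "c u v"] inner_commute[of v "c u w"]
    inner_commute[of u "c v w"] inner_commute[of u "c w v"]
  unfolding om_def inner_diff_left by linarith

lemma cov_deriv_fld:
  assumes "multilinear_on m t" "length vs = m"
  shows "cov_deriv (g k) (fld t k) x u vs = dersum (om (E x u)) t (map (E x) vs)"
proof -
  have m: "multilinear_on (length vs) t" "multilinear_on (length (map (E x) vs)) t"
    using assms by simp_all
  have "(\<Sum>i<length vs. fld t k x (vs[i := christoffel (g k) x u (vs ! i)]))
      = dersum (C (E x u)) t (map (E x) vs)"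
    unfolding dersum_conv_sum by (simp add: fld_def map_update christoffel_g E_F)
  then show ?thesis
    unfolding cov_deriv_def fld_frechet[OF m(1)]
    using dersum_map_diff[OF m(2)] by (simp add: om_def[abs_def])
qed

lemma act_fld:
  assumes "\<And>v w. a [v, w] = A (E x v) \<bullet> E x w"
  shows "act (g k x) a (fld t k x) vs = - dersum A t (map (E x) vs)"
proof -
  have "sharp (g k x) (\<lambda>w. a [v, w]) = F x (A (E x v))" for v
    by (rule sharp_g) (simp add: assms)
  then show ?thesis unfolding act_def dersum_conv_sum by (simp add: fld_def map_update E_F)
qed

end

section \<open>Intrinsic torsion and curvature\<close>

lemma length_2_iff: "length vs = 2 \<longleftrightarrow> (\<exists>u v. vs = [u, v])"
  by (auto simp: length_Suc_conv numeral_2_eq_2)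

lemma multilinear_on_3I:
  assumes "\<And>v w. linear (\<lambda>u. t [u, v, w])" "\<And>u w. linear (\<lambda>v. t [u, v, w])" "\<And>u v. linear (\<lambda>w. t [u, v, w])"
  shows "multilinear_on 3 t"
proof (rule multilinear_onI)
  fix us ws :: "(real^8) list"
  assume "length us + 1 + length ws = 3"
  then have "(length us = 0 \<and> length ws = 2) \<or> (length us = 1 \<and> length ws = 1) \<or> (length us = 2 \<and> length ws = 0)"
    by linarith
  then show "linear (\<lambda>v. t (us @ v # ws))"
    using assms by (auto simp: length_Suc_conv length_2_iff)
qed

text \<open>The stabilizer algebra read in the coframe, as a linear subspace of matrices that is the
  same at all points.\<close>

definition skew_stab :: "nat \<Rightarrow> tensor \<Rightarrow> (real^8^8) set" where
  "skew_stab m t = {M. (\<forall>v. (M *v v) \<bullet> v = 0) \<and> (\<forall>vs. length vs = m \<longrightarrow> dersum ((*v) M) t vs = 0)}"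

lemma dersum_matrix_add:
  assumes "multilinear_on (length vs) t"
  shows "dersum ((*v) (M + N)) t vs = dersum ((*v) M) t vs + dersum ((*v) N) t vs"
  using dersum_map_add[OF assms, of "(*v) M" "(*v) N"] by (simp add: matrix_vector_mult_add_rdistrib[abs_def])

lemma scaleR_matrix_vector: "(r *\<^sub>R M) *v v = r *\<^sub>R (M *v v)" for M :: "real^8^8"
  by (simp add: scaleR_matrix_vector_assoc)

lemma dersum_matrix_scale:
  assumes "multilinear_on (length vs) t"
  shows "dersum ((*v) (r *\<^sub>R M)) t vs = r * dersum ((*v) M) t vs"
proof -
  have "(*v) (r *\<^sub>R M) = (\<lambda>v. r *\<^sub>R (M *v v))" by (rule ext) (rule scaleR_matrix_vector)
  then show ?thesis using dersum_map_scale[OF assms, of r "(*v) M"] by simp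
qed

lemma dersum_matrix_zero:
  assumes "multilinear_on (length vs) t"
  shows "dersum ((*v) 0) t vs = 0"
  using dersum_matrix_scale[OF assms, of 0 0] by simp

lemma subspace_skew_stab:
  assumes "multilinear_on m t"
  shows "subspace (skew_stab m t)"
  unfolding subspace_def skew_stab_def using assms
  by (auto simp: matrix_vector_mult_add_rdistrib inner_add_left scaleR_matrix_vector
      dersum_matrix_add dersum_matrix_scale dersum_matrix_zero)

lemma matrix_inner_sum: "(\<Sum>i\<in>UNIV. \<Sum>j\<in>UNIV. ((M *v axis i 1) \<bullet> axis j 1) * ((N *v axis i 1) \<bullet> axis j 1)) = M \<bullet> N"
  for M N :: "real^8^8"
proof -
  have "(M *v axis i 1) \<bullet> axis j 1 = M $ j $ i" for M :: "real^8^8" and i j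
    by (simp add: matrix_vector_mul_component inner_axis)
  then show ?thesis by (simp add: inner_vec_def sum.swap[of "\<lambda>i j. M $ j $ i * N $ j $ i"])
qed

context nil_coframe begin

lemma om_linear_left: "linear (\<lambda>u. om u v)" and om_linear_right: "linear (om u)"
  unfolding om_def[abs_def] linear_iff
  by (simp_all add: c.add_left c.add_right C.add_left C.add_right c.scaleR_left c.scaleR_right
      C.scaleR_left C.scaleR_right algebra_simps)

text \<open>
  The component of the connection form \<open>om u\<close> orthogonal to the stabilizer algebra; it acts on \<open>t\<close> as
  \<open>om u\<close> does, so that it is the intrinsic torsion up to sign.
\<close>

definition om_perp :: "nat \<Rightarrow> tensor \<Rightarrow> real^8 \<Rightarrow> real^8^8" where
  "om_perp m t u = (\<Sum>i\<in>UNIV. u $ i *\<^sub>R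
     (SOME z. (\<forall>w\<in>skew_stab m t. z \<bullet> w = 0) \<and> matrix (om (axis i 1)) - z \<in> skew_stab m t))"

lemma om_perp_linear: "linear (om_perp m t)"
  unfolding linear_iff om_perp_def by (simp add: scaleR_left_distrib sum.distrib scaleR_sum_right)

text \<open>The choice is made on basis vectors only and extended linearly. Both properties survive
  the extension because \<open>skew_stab\<close> is a subspace.\<close>

lemma om_perp_props:
  assumes "multilinear_on m t"
  shows om_perp_orthogonal: "w \<in> skew_stab m t \<Longrightarrow> om_perp m t u \<bullet> w = 0"
    and om_minus_om_perp: "matrix (om u) - om_perp m t u \<in> skew_stab m t"
proof -
  define z where "z i = (SOME z. (\<forall>w\<in>skew_stab m t. z \<bullet> w = 0) \<and> matrix (om (axis i 1)) - z \<in> skew_stab m t)" for i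
  have z: "(\<forall>w\<in>skew_stab m t. z i \<bullet> w = 0) \<and> matrix (om (axis i 1)) - z i \<in> skew_stab m t" for i
    unfolding z_def
  proof (rule someI_ex)
    \<comment> \<open>Existence is the orthogonal decomposition of the connection matrix with
      respect to the stabilizer algebra.\<close>
    obtain y z where yz: "y \<in> span (skew_stab m t)" "\<And>w. w \<in> span (skew_stab m t) \<Longrightarrow> orthogonal z w"
      "matrix (om (axis i 1)) = y + z"
      using orthogonal_subspace_decomp_exists[of "skew_stab m t" "matrix (om (axis i 1))"] by metis
    moreover have "span (skew_stab m t) = skew_stab m t"
      using subspace_skew_stab[OF assms] by (simp add: span_eq_iff)
    ultimately show "\<exists>z. (\<forall>w\<in>skew_stab m t. z \<bullet> w = 0) \<and> matrix (om (axis i 1)) - z \<in> skew_stab m t"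
      by (intro exI[of _ z]) (simp add: orthogonal_def)
  qed
  have e: "om_perp m t u = (\<Sum>i\<in>UNIV. u $ i *\<^sub>R z i)" by (simp add: om_perp_def z_def)
  show "om_perp m t u \<bullet> w = 0" if "w \<in> skew_stab m t"
    using z that by (simp add: e inner_sum_left)
  have "linear (\<lambda>u. matrix (om u))"
    using om_linear_left by (simp add: linear_iff matrix_def vec_eq_iff)
  from linear_expand[OF this, of u]
  have "matrix (om u) - om_perp m t u = (\<Sum>i\<in>UNIV. u $ i *\<^sub>R (matrix (om (axis i 1)) - z i))"
    by (simp add: e scaleR_right_diff_distrib sum_subtractf)
  then show "matrix (om u) - om_perp m t u \<in> skew_stab m t"
    using z subspace_skew_stab[OF assms] by (simp add: subspace_sum subspace_scale)
qed

lemma om_perp_skew: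
  assumes "multilinear_on m t"
  shows "(om_perp m t u *v v) \<bullet> v = 0"
proof -
  have "((matrix (om u) - om_perp m t u) *v v) \<bullet> v = 0"
    using om_minus_om_perp[OF assms, of u] by (simp add: skew_stab_def)
  moreover have "matrix (om u) *v v = om u v"
    using fun_cong[OF matrix_vector_mul(2)[OF om_linear_right]] .
  moreover have "om u v \<bullet> v = 0" using om_skew[of u v v] by simp
  ultimately show ?thesis by (simp add: matrix_vector_mult_diff_rdistrib inner_diff_left)
qed

lemma dersum_om_perp:
  assumes "multilinear_on m t" "length vs = m"
  shows "dersum ((*v) (om_perp m t u)) t vs = dersum (om u) t vs"
proof -
  have m: "multilinear_on (length vs) t" using assms by simp
  let ?D = "matrix (om u) - om_perp m t u"
  have "dersum ((*v) ?D) t vs = 0" using om_minus_om_perp[OF assms(1), of u] assms(2) by (simp add: skew_stab_def)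
  moreover have "dersum ((*v) (?D + om_perp m t u)) t vs = dersum ((*v) ?D) t vs + dersum ((*v) (om_perp m t u)) t vs"
    by (rule dersum_matrix_add[OF m])
  moreover have "(*v) (?D + om_perp m t u) = om u"
    using matrix_vector_mul(2)[OF om_linear_right, of u] by simp
  ultimately show ?thesis by simp
qed

text \<open>The sign compensates for the minus sign in \<open>act\<close>.\<close>

definition tor0 :: "nat \<Rightarrow> tensor \<Rightarrow> tensor" where
  "tor0 m t vs = - ((om_perp m t (vs ! 0) *v (vs ! 1)) \<bullet> (vs ! 2))"

lemma multilinear_on_tor0: "multilinear_on 3 (tor0 m t)"
  by (rule multilinear_on_3I)
     (simp_all add: tor0_def linear_iff linear_add[OF om_perp_linear] linear_scale[OF om_perp_linear]
       matrix_vector_mult_add_rdistrib scaleR_matrix_vector inner_add_left inner_add_right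
       matrix_vector_right_distrib matrix_vector_mult_scaleR)

lemma inner_2form_g:
  assumes "\<And>v w. a [v, w] = (M *v E x v) \<bullet> E x w" "\<And>v w. b' [v, w] = (N *v E x v) \<bullet> E x w"
  shows "inner_2form (g k x) a b' = (M \<bullet> N) / 2"
proof -
  let ?G = "\<lambda>i. adjoint (F x) (axis i 1)" and ?E = "\<lambda>i. E x (axis i 1)"
  note inv = contraction_invariant[OF E_linear F_linear E_F]
  have l: "linear (\<lambda>v. (A *v v) \<bullet> w)" "linear (\<lambda>w. (A *v v) \<bullet> w)" for A :: "real^8^8" and v w
    by (simp_all add: linear_iff inner_add_left inner_add_right matrix_vector_right_distrib matrix_vector_mult_scaleR)
  have "(\<Sum>i\<in>UNIV. \<Sum>j\<in>UNIV. ((M *v ?G i) \<bullet> ?G j) * ((N *v ?E i) \<bullet> ?E j))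
      = (\<Sum>i\<in>UNIV. \<Sum>j\<in>UNIV. ((M *v ?G i) \<bullet> axis j 1) * ((N *v ?E i) \<bullet> axis j 1))"
    by (rule sum.cong[OF refl]) (rule inv[OF l(2) l(2)])
  also have "\<dots> = (\<Sum>j\<in>UNIV. \<Sum>i\<in>UNIV. ((M *v ?G i) \<bullet> axis j 1) * ((N *v ?E i) \<bullet> axis j 1))"
    by (rule sum.swap)
  also have "\<dots> = (\<Sum>j\<in>UNIV. \<Sum>i\<in>UNIV. ((M *v axis i 1) \<bullet> axis j 1) * ((N *v axis i 1) \<bullet> axis j 1))"
    by (rule sum.cong[OF refl]) (rule inv[OF l(1) l(1)])
  also have "\<dots> = M \<bullet> N"
    by (subst sum.swap) (rule matrix_inner_sum)
  finally show ?thesis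
    unfolding inner_2form_def assms raised_vec_g E_F by simp
qed

text \<open>Translates an arbitrary 2-form of the stabilizer algebra at a point into a coframe
  matrix, so that orthogonality can be tested against \<open>skew_stab\<close>.\<close>

lemma stab_algebra_matrix:
  assumes b': "b' \<in> stab_algebra (g k x) m (fld t k x)"
  obtains N where "N \<in> skew_stab m t" "\<And>v w. b' [v, w] = (N *v E x v) \<bullet> E x w"
proof -
  have alt: "multilinear_on 2 b'" "b' [v, v] = 0" for v
    using b' by (auto simp: stab_algebra_def alt_forms_def alternating_on_def)
  have l1: "linear (\<lambda>v. b' [F x v, w])" for w
    using linear_compose[OF F_linear[of x], of "\<lambda>v. b' [v, w]"] multilinear_onD[OF alt(1), of "[]" "[w]"]
    by (simp add: o_def)
  have l2: "linear (\<lambda>w. b' [v, F x w])" for v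
    using linear_compose[OF F_linear[of x], of "\<lambda>w. b' [v, w]"] multilinear_onD[OF alt(1), of "[v]" "[]"]
    by (simp add: o_def)
  define N :: "real^8^8" where "N = (\<chi> i j. b' [F x (axis j 1), F x (axis i 1)])"
  have N: "(N *v v) \<bullet> w = b' [F x v, F x w]" for v w
  proof -
    have "b' [F x v, F x w] = (\<Sum>i\<in>UNIV. w $ i * b' [F x v, F x (axis i 1)])"
      using linear_expand[OF l2[of "F x v"], of w] by simp
    also have "\<dots> = (\<Sum>i\<in>UNIV. w $ i * (\<Sum>j\<in>UNIV. v $ j * b' [F x (axis j 1), F x (axis i 1)]))"
      using linear_expand[OF l1, of v] by simp
    finally show ?thesis
      by (simp add: N_def inner_vec_def matrix_vector_mult_def mult.commute)
  qed
  have b: "b' [v, w] = (N *v E x v) \<bullet> E x w" for v w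
    by (simp add: N F_E)
  have "dersum ((*v) N) t vs = 0" if "length vs = m" for vs
  proof -
    have "act (g k x) b' (fld t k x) (map (F x) vs) = - dersum ((*v) N) t (map (E x) (map (F x) vs))"
      by (rule act_fld) (rule b)
    moreover have "act (g k x) b' (fld t k x) (map (F x) vs) = 0"
      using b' that by (simp add: stab_algebra_def)
    ultimately show ?thesis by (simp add: o_def E_F)
  qed
  then have "N \<in> skew_stab m t" by (simp add: skew_stab_def N alt(2))
  then show ?thesis using b that by blast
qed

lemma torsion_fld:
  assumes t: "multilinear_on m t"
  shows "intrinsic_torsion atlas g m (fld t) (fld (tor0 m t))"
  unfolding intrinsic_torsion_def
proof (intro conjI ballI allI impI)
  show "tensor_field atlas 3 (fld (tor0 m t))" by (rule tensor_field_fld[OF multilinear_on_tor0])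
next
  fix k x u
  let ?a = "\<lambda>vs. fld (tor0 m t) k x (u # vs)"
  let ?K = "om_perp m t (E x u)"
  have a: "?a [v, w] = ((- ?K) *v E x v) \<bullet> E x w" for v w
    by (simp add: fld_def tor0_def vector_scaleR_matrix_ac scaleR_matrix_vector[of "-1", simplified])
  have "multilinear_on 3 (fld (tor0 m t) k x)"
    unfolding fld_def[abs_def] by (rule multilinear_on_map[OF multilinear_on_tor0 E_linear])
  then have "multilinear_on 2 ?a" by (intro multilinear_on_Cons) (simp add: numeral_eq_Suc)
  moreover have "?a vs = 0" if "length vs = 2" "\<not> distinct vs" for vs
  proof -
    from that obtain v where "vs = [v, v]" by (auto simp: length_2_iff)
    then show ?thesis using om_perp_skew[OF t, of "E x u" "E x v"] by (simp add: fld_def tor0_def)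
  qed
  ultimately have "?a \<in> alt_forms 2" by (simp add: alt_forms_def alternating_on_def)
  moreover have "inner_2form (g k x) ?a b' = 0" if b': "b' \<in> stab_algebra (g k x) m (fld t k x)" for b'
  proof -
    obtain N where N: "N \<in> skew_stab m t" "\<And>v w. b' [v, w] = (N *v E x v) \<bullet> E x w"
      using stab_algebra_matrix[OF b'] by blast
    show ?thesis unfolding inner_2form_g[OF a N(2)] using om_perp_orthogonal[OF t N(1)] by simp
  qed
  ultimately show "?a \<in> stab_perp (g k x) m (fld t k x)" by (simp add: stab_perp_def)
  fix vs :: "(real^8) list" assume vs: "length vs = m"
  then have m: "multilinear_on (length (map (E x) vs)) t" using t by simp
  have "act (g k x) ?a (fld t k x) vs = - dersum ((*v) (- ?K)) t (map (E x) vs)"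
    by (rule act_fld) (rule a)
  also have "\<dots> = dersum ((*v) ?K) t (map (E x) vs)"
    using dersum_matrix_scale[OF m, of "-1" ?K] by simp
  also have "\<dots> = cov_deriv (g k) (fld t k) x u vs"
    using vs dersum_om_perp[OF t, of "map (E x) vs" "E x u"] cov_deriv_fld[OF t vs] by simp
  finally show "cov_deriv (g k) (fld t k) x u vs = act (g k x) ?a (fld t k x) vs" ..
qed

text \<open>If the torsion were zero, \<open>om_perp\<close> in direction u would be zero; but it
  acts on t exactly as \<open>om u\<close> does. Testing at the point 0 on vectors
  \<open>F 0 v\<close> undoes the coframe.\<close>

lemma nonvanishing_fld:
  assumes t: "multilinear_on m t" and ne: "length ws = m" "dersum (om u) t ws \<noteq> 0"
  shows "nonvanishing_torsion atlas g m (fld t)"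
proof -
  obtain k where k: "k \<in> atlas" "0 \<in> chart_im k" using ex_chart by blast
  have "\<exists>vs. length vs = 3 \<and> fld (tor0 m t) k 0 vs \<noteq> 0"
  proof (rule ccontr)
    assume "\<not> ?thesis"
    then have "fld (tor0 m t) k 0 [F 0 u, F 0 v, F 0 w] = 0" for v w by simp
    then have "(om_perp m t u *v v) \<bullet> w = 0" for v w by (simp add: fld_def tor0_def E_F)
    then have z: "om_perp m t u *v v = 0" for v by (metis inner_eq_zero_iff)
    have "multilinear_on (length ws) t" using t ne by simp
    from dersum_map_zero[OF this] have "dersum ((*v) (om_perp m t u)) t ws = 0" by (simp add: z[abs_def])
    then show False using dersum_om_perp[OF t ne(1)] ne(2) by simp
  qed
  then show ?thesis unfolding nonvanishing_torsion_def using torsion_fld[OF t] k by blast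
qed

text \<open>
  The curvature of a constant coefficient connection, with correction terms since constant vector
  fields in a chart do not have constant coefficients in the coframe.
\<close>

definition Rm :: "real^8 \<Rightarrow> real^8 \<Rightarrow> real^8 \<Rightarrow> real^8" where
  "Rm u v w = C (c u v) w + C v (c u w) - c u (C v w)
     - (C (c v u) w + C u (c v w) - c v (C u w)) + C u (C v w) - C v (C u w)"

text \<open>Identifies the derivative of \<open>F x z\<close> along h as minus
  \<open>F x (c (E x h) z)\<close>; this is the source of the terms in \<open>Rm\<close> that start
  with \<open>c\<close>.\<close>

lemma F_c: "F x (c (E x h) z) = b h (Q z)"
  by (simp add: c_eq F_def E_def Q_P b_simps)

lemma christoffel_has_derivative:
  "((\<lambda>y. christoffel (g k) y v w) has_derivative
    (\<lambda>h. F x (C (c (E x h) (E x v)) (E x w) + C (E x v) (c (E x h) (E x w)) - c (E x h) (C (E x v) (E x w))))) (at x)"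
proof -
  have Q: "bounded_linear Q" using Q_linear by (simp add: linear_conv_bounded_linear)
  have 1: "((\<lambda>y. C (E y v) (E y w)) has_derivative
      (\<lambda>h. C (E x v) (c (E x h) (E x w)) + C (c (E x h) (E x v)) (E x w))) (at x)"
    by (rule C.FDERIV[OF E_has_derivative E_has_derivative])
  note 2 = bounded_linear.has_derivative[OF Q 1]
  note 3 = has_derivative_diff[OF 2 b.FDERIV[OF has_derivative_ident 2]]
  have e: "christoffel (g k) y v w = Q (C (E y v) (E y w)) - b y (Q (C (E y v) (E y w)))" for y
    by (simp add: christoffel_g F_def)
  show ?thesis
    unfolding e
    by (rule has_derivative_eq_rhs[OF 3])
       (simp add: fun_eq_iff linear_diff[OF F_linear] linear_add[OF F_linear] F_c, simp add: F_def linear_add[OF Q_linear] b_simps)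
qed

lemma riemann_g: "riemann (g k) x u v w = F x (Rm (E x u) (E x v) (E x w))"
proof -
  have d: "frechet_derivative (\<lambda>y. christoffel (g k) y v w) (at x) u
      = F x (C (c (E x u) (E x v)) (E x w) + C (E x v) (c (E x u) (E x w)) - c (E x u) (C (E x v) (E x w)))" for u v w
    using fun_cong[OF frechet_derivative_at[OF christoffel_has_derivative[where k = k and v = v and w = w and x = x]], of u]
    by simp
  show ?thesis
    unfolding riemann_def d by (simp add: christoffel_g E_F Rm_def linear_diff[OF F_linear] linear_add[OF F_linear])
qed

lemma Rm_linear: "linear (\<lambda>u. Rm u v w)"
  unfolding linear_iff Rm_def
  by (simp add: c.add_left c.add_right C.add_left C.add_right c.scaleR_left c.scaleR_right
      C.scaleR_left C.scaleR_right algebra_simps)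

lemma ricci_g: "ricci (g k) x v w = (\<Sum>i\<in>UNIV. Rm (axis i 1) (E x v) (E x w) $ i)"
  unfolding ricci_def riemann_g
  by (rule trace_invariant[OF E_linear F_linear Rm_linear E_F])

text \<open>By \<open>ricci_g\<close> the Ricci tensor is constant in the coframe, so evaluation at
  a single point gives an algebraic identity for all vectors.\<close>

lemma einstein_ricci:
  assumes "einstein atlas g"
  obtains \<kappa> where "\<And>v w. (\<Sum>i\<in>UNIV. Rm (axis i 1) v w $ i) = \<kappa> * (v \<bullet> w)"
proof -
  from assms obtain \<kappa> where e: "\<forall>k\<in>atlas. \<forall>x\<in>chart_im k. \<forall>v w. ricci (g k) x v w = \<kappa> * g k x [v, w]"
    by (auto simp: einstein_def)
  obtain k where "k \<in> atlas" "0 \<in> chart_im k" using ex_chart by blast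
  then have "ricci (g k) 0 (F 0 v) (F 0 w) = \<kappa> * g k 0 [F 0 v, F 0 w]" for v w using e by blast
  then show ?thesis by (intro that[of \<kappa>]) (simp add: ricci_g g_eq E_F)
qed

end

section \<open>The example for \<open>PSU(3)\<close>\<close>

definition rho_list :: "(real \<times> 8 list) list" where
  "rho_list = [(1/2, [1,2,3]), (1/4, [1,4,7]), (-1/4, [1,5,6]), (1/4, [2,4,6]), (1/4, [2,5,7]),
     (1/4, [3,4,5]), (-1/4, [3,6,7]), (sqrt 3 / 4, [8,4,5]), (sqrt 3 / 4, [8,6,7])]"

lemma rho0_eq_lform: "rho0 = lform rho_list"
  by (rule ext) (simp add: rho0_def rho_list_def algebra_simps)

definition rho_c :: "real^8 \<Rightarrow> real^8 \<Rightarrow> real^8" where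
  "rho_c u v = (\<chi> i. if i = 8 then u $ 4 * v $ 7 + u $ 5 * v $ 6 else 0)"

lemma dext_rho_c:
  assumes "\<And>a I. (a, I) \<in> set L \<Longrightarrow> length I = k" "length vs = Suc k"
  shows "dext rho_c (lform L) vs = lform (concat (map (\<lambda>(a, I). map (\<lambda>(b, M). (a * b, M))
    (dlist (\<lambda>i. if i = 8 then [(1, 4, 7), (1, 5, 6)] else []) I)) L)) vs"
  by (rule dext_lform[OF _ assms]) (auto simp: rho_c_def)

lemma dext_rho: "length vs = 4 \<Longrightarrow> dext rho_c rho0 vs = 0"
  unfolding rho0_eq_lform
  by (subst dext_rho_c[where k = 3]) (auto simp: rho_list_def ecov_repeat ecov_sort ix_def)

text \<open>In the star of rho, e8 is multiplied by e4567 and by products of two of e1, e2, e3 with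
  anti-self-dual forms. Wedging with the self-dual form e47 + e56 kills the former by degree and the
  latter by duality.\<close>

lemma dext_star_rho:
  assumes "length vs = 6"
  shows "dext rho_c (star0 3 rho0) vs = 0"
proof -
  let ?L = "concat (map (\<lambda>(a, I). map (\<lambda>(b, M). (a * b, M)) (contrs I [1,2,3,4,5,6,7,8])) rho_list)"
  have "dext rho_c (star0 3 rho0) vs = dext rho_c (lform ?L) vs"
    unfolding rho0_eq_lform using assms
    by (intro dext_cong star0_lform) (auto simp: rho_list_def)
  also have "\<dots> = 0"
    using assms by (subst dext_rho_c[where k = 5]) (auto simp: rho_list_def ecov_repeat ecov_sort ix_def)
  finally show ?thesis .
qed

text \<open>The solution of the Koszul identity for \<open>rho_c\<close>. It is symmetric in u and
  v, as constant vector fields commute.\<close>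

definition rho_C :: "real^8 \<Rightarrow> real^8 \<Rightarrow> real^8" where
  "rho_C u v = (\<chi> i.
     if i = 8 then (u $ 4 * v $ 7 + u $ 5 * v $ 6 + v $ 4 * u $ 7 + v $ 5 * u $ 6) / 2
     else if i = 7 then (u $ 8 * v $ 4 + v $ 8 * u $ 4) / 2
     else if i = 6 then (u $ 8 * v $ 5 + v $ 8 * u $ 5) / 2
     else if i = 5 then - (u $ 8 * v $ 6 + v $ 8 * u $ 6) / 2
     else if i = 4 then - (u $ 8 * v $ 7 + v $ 8 * u $ 7) / 2 else 0)"

lemma inner_8:
  "(u :: real^8) \<bullet> v = u$1 * v$1 + u$2 * v$2 + u$3 * v$3 + u$4 * v$4 + u$5 * v$5 + u$6 * v$6 + u$7 * v$7 + u$8 * v$8"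
  by (simp add: inner_vec_def sum_8)

interpretation nil_rho: nil_coframe rho_c "{8}" "\<lambda>v. v" "\<lambda>v. v" rho_c rho_C
proof unfold_locales
  show "bilinear rho_c"
    by (simp add: bilinear_def linear_iff vec_eq_iff rho_c_def algebra_simps)
  show "u \<in> lat \<Longrightarrow> v \<in> lat \<Longrightarrow> rho_c u v \<in> lat" for u v
    by (simp add: lat_def rho_c_def)
  show "det (matrix (\<lambda>v :: real^8. v)) > 0"
    by (simp add: matrix_id_mat_1[unfolded id_def])
  show "2 * (rho_C u v \<bullet> w) = rho_c u v \<bullet> w + v \<bullet> rho_c u w + rho_c v u \<bullet> w + u \<bullet> rho_c v w - rho_c w u \<bullet> v - u \<bullet> rho_c w v" for u v w
    unfolding inner_8 by (simp add: rho_c_def rho_C_def field_simps)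
qed (auto simp: rho_c_def vec_eq_iff linear_iff)

lemma rho_alt: "rho0 \<in> alt_forms 3"
  unfolding rho0_eq_lform by (rule lform_alt_forms) (auto simp: rho_list_def)

text \<open>\<open>om\<close> in direction e8 rotates e45 + e67 into e46 - e57, so the e8 term of
  rho is not parallel; the value found is sqrt 3 / 4.\<close>

lemma rho_torsion: "dersum (nil_rho.om (axis 8 1)) rho0 (map basis_vec [8,4,6]) \<noteq> 0"
proof -
  \<comment> \<open>The rows of the matrix of \<open>om (axis 8 1)\<close>, which is minus
    \<open>rho_C (axis 8 1)\<close> because \<open>rho_c\<close> vanishes there.\<close>
  let ?R = "\<lambda>i::8. if i = 7 then [(-1/2, 4)] else if i = 6 then [(-1/2, 5)]
    else if i = 5 then [(1/2, 6)] else if i = 4 then [(1/2, 7)] else [] :: (real \<times> 8) list"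
  have "nil_rho.om (axis 8 1) v $ i = (\<Sum>(a, p)\<leftarrow>?R i. a * v $ p)" for v i
    by (auto simp: nil_rho.om_def rho_c_def rho_C_def axis_def)
  then have e: "dersum (nil_rho.om (axis 8 1)) rho0 (map basis_vec [8,4,6])
     = lform (concat (map (\<lambda>(a, I). map (\<lambda>(b, M). (a * b, M)) (alist ?R I)) rho_list)) (map basis_vec [8,4,6])"
    unfolding rho0_eq_lform by (rule dersum_lform) (auto simp: rho_list_def)
  have "ecov J [axis 8 1, axis 4 1, axis 6 1] = lform (contrs [8,4,6] J) []" if "length J = 3" for J
    using ecov_axes[of J "[8,4,6]" "[]"] that by simp
  then show ?thesis unfolding e by (simp add: rho_list_def)
qed

text \<open>The direction e1 splits off as a flat factor, whereas e8 spans the commutators of the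
  group.\<close>

lemma not_einstein_rho: "\<not> einstein nil_rho.atlas nil_rho.g"
proof
  assume "einstein nil_rho.atlas nil_rho.g"
  then obtain \<kappa> where k: "\<And>v w. (\<Sum>i\<in>UNIV. nil_rho.Rm (axis i 1) v w $ i) = \<kappa> * (v \<bullet> w)"
    using nil_rho.einstein_ricci by blast
  have "(\<Sum>i\<in>UNIV. nil_rho.Rm (axis i 1) (axis 1 1) (axis 1 1) $ i) = 0"
    by (simp add: sum_8 nil_rho.Rm_def rho_c_def rho_C_def axis_def)
  moreover have "(\<Sum>i\<in>UNIV. nil_rho.Rm (axis i 1) (axis 8 1) (axis 8 1) $ i) \<noteq> 0"
    by (simp add: sum_8 nil_rho.Rm_def rho_c_def rho_C_def axis_def)
  ultimately show False unfolding k by (simp add: inner_axis)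
qed

lemma harmonic_PSU3_nilmanifold:
  "manifold8 nil_rho.quot nil_rho.atlas \<and> compact_space nil_rho.quot \<and>
    harmonic_PSU3_structure nil_rho.atlas (nil_rho.fld rho0) nil_rho.g \<and>
    nonvanishing_torsion nil_rho.atlas nil_rho.g 3 (nil_rho.fld rho0) \<and> \<not> einstein nil_rho.atlas nil_rho.g"
proof -
  have m: "multilinear_on 3 rho0" using rho_alt by (simp add: alt_forms_def)
  have "harmonic nil_rho.atlas nil_rho.g 3 (nil_rho.fld rho0)"
    by (rule nil_rho.harmonic_fld[OF m]) (simp_all add: dext_rho dext_star_rho)
  moreover have "nonvanishing_torsion nil_rho.atlas nil_rho.g 3 (nil_rho.fld rho0)"
    by (rule nil_rho.nonvanishing_fld[OF m _ rho_torsion]) simp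
  ultimately show ?thesis
    using nil_rho.manifold_quot nil_rho.compact_quot nil_rho.PSU3_fld[OF rho_alt] not_einstein_rho
    by (simp add: harmonic_PSU3_structure_def)
qed

section \<open>The example for \<open>Sp(1)\<cdot>Sp(2)\<close>\<close>

definition Omega_list :: "(real \<times> 8 list) list" where
  "Omega_list = [(-6, [1,2,3,4]), (2, [1,2,5,6]), (-2, [1,2,7,8]), (2, [1,3,5,7]), (2, [1,3,6,8]),
     (2, [1,4,5,8]), (-2, [1,4,6,7]), (-2, [2,3,5,8]), (2, [2,3,6,7]), (2, [2,4,5,7]), (2, [2,4,6,8]),
     (-2, [3,4,5,6]), (2, [3,4,7,8]), (-6, [5,6,7,8])]"

lemma Omega0_eq_lform: "Omega0 = lform Omega_list"
  by (rule ext) (simp add: Omega0_def Omega_list_def algebra_simps)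

text \<open>
  Here \<open>Omega_c u v = u\<^sub>1 N v\<close> with \<open>N\<^sup>2 = 0\<close>. The image of \<open>N\<close> is spanned by \<open>\<surd>3 e\<^sub>2 + e\<^sub>5\<close> and \<open>\<surd>3 e\<^sub>3 + e\<^sub>8\<close>,
  which \<open>Omega_P\<close> takes as lattice directions, so that \<open>N\<close> becomes integral in \<open>Omega_b\<close>.
\<close>

definition Omega_c :: "real^8 \<Rightarrow> real^8 \<Rightarrow> real^8" where
  "Omega_c u v = (\<chi> i. u $ 1 *
     (if i = 2 then sqrt 3 * v $ 3 - 3 * v $ 8 else if i = 3 then 3 * v $ 5 - sqrt 3 * v $ 2
      else if i = 5 then v $ 3 - sqrt 3 * v $ 8 else if i = 8 then sqrt 3 * v $ 5 - v $ 2 else 0))"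

lemma dext_Omega_c:
  assumes "\<And>a I. (a, I) \<in> set L \<Longrightarrow> length I = k" "length vs = Suc k"
  shows "dext Omega_c (lform L) vs = lform (concat (map (\<lambda>(a, I). map (\<lambda>(b, M). (a * b, M))
    (dlist (\<lambda>i. if i = 2 then [(sqrt 3, 1, 3), (-3, 1, 8)] else if i = 3 then [(3, 1, 5), (- sqrt 3, 1, 2)]
      else if i = 5 then [(1, 1, 3), (- sqrt 3, 1, 8)] else if i = 8 then [(sqrt 3, 1, 5), (-1, 1, 2)] else []) I)) L)) vs"
  by (rule dext_lform[OF _ assms]) (auto simp: Omega_c_def algebra_simps)

lemma dext_Omega: "length vs = 5 \<Longrightarrow> dext Omega_c Omega0 vs = 0"
  unfolding Omega0_eq_lform
  by (subst dext_Omega_c[where k = 4]) (auto simp: Omega_list_def ecov_repeat ecov_sort ix_def)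

lemma star_Omega: "length vs = 4 \<Longrightarrow> star0 4 Omega0 vs = Omega0 vs"
  unfolding Omega0_eq_lform
  by (subst star0_lform[where k = 4]) (auto simp: Omega_list_def)

lemma dext_star_Omega:
  assumes "length vs = 5"
  shows "dext Omega_c (star0 4 Omega0) vs = 0"
  using dext_Omega[OF assms] dext_cong[of vs "star0 4 Omega0" Omega0 Omega_c] assms by (simp add: star_Omega)
definition Omega_b :: "real^8 \<Rightarrow> real^8 \<Rightarrow> real^8" where
  "Omega_b u v = (\<chi> i. if i = 5 then u $ 1 * v $ 3 else if i = 8 then - (u $ 1 * v $ 2) else 0)"

definition Omega_P :: "real^8 \<Rightarrow> real^8" where
  "Omega_P v = (\<chi> i. if i = 2 then v $ 2 + sqrt 3 * v $ 5 else if i = 3 then v $ 3 + sqrt 3 * v $ 8 else v $ i)"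

definition Omega_Q :: "real^8 \<Rightarrow> real^8" where
  "Omega_Q v = (\<chi> i. if i = 2 then v $ 2 - sqrt 3 * v $ 5 else if i = 3 then v $ 3 - sqrt 3 * v $ 8 else v $ i)"

text \<open>With S the symmetric part of N this is u1 S v + v1 S u - (S u, v) e1.\<close>

definition Omega_C :: "real^8 \<Rightarrow> real^8 \<Rightarrow> real^8" where
  "Omega_C u v = (\<chi> i.
     if i = 1 then 2 * (u $ 2 * v $ 8 + u $ 8 * v $ 2 - u $ 3 * v $ 5 - u $ 5 * v $ 3)
     else if i = 2 then - 2 * (u $ 1 * v $ 8 + v $ 1 * u $ 8)
     else if i = 8 then - 2 * (u $ 1 * v $ 2 + v $ 1 * u $ 2)
     else if i = 3 then 2 * (u $ 1 * v $ 5 + v $ 1 * u $ 5)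
     else if i = 5 then 2 * (u $ 1 * v $ 3 + v $ 1 * u $ 3) else 0)"

interpretation nil_Omega: nil_coframe Omega_b "{5, 8}" Omega_P Omega_Q Omega_c Omega_C
proof unfold_locales
  show "bilinear Omega_b"
    by (simp add: bilinear_def linear_iff vec_eq_iff Omega_b_def algebra_simps)
  show "u \<in> lat \<Longrightarrow> v \<in> lat \<Longrightarrow> Omega_b u v \<in> lat" for u v
    by (simp add: lat_def Omega_b_def)
  \<comment> \<open>Off the identity, \<open>Omega_P\<close> only sends e5 and e8 to multiples of e2
    and e3, so that part squares to zero.\<close>
  have "det (matrix (\<lambda>v. v + (\<chi> i. if i = 2 then sqrt 3 * v $ 5 else if i = 3 then sqrt 3 * v $ 8 else 0 :: real^8))) > 0"
    by (rule det_unipotent) (auto simp: linear_iff vec_eq_iff algebra_simps)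
  moreover have "(\<lambda>v. v + (\<chi> i. if i = 2 then sqrt 3 * v $ 5 else if i = 3 then sqrt 3 * v $ 8 else 0 :: real^8)) = Omega_P"
    by (auto simp: Omega_P_def vec_eq_iff)
  ultimately show "det (matrix Omega_P) > 0" by simp
  show "Omega_c (Omega_P u) (Omega_P v) = Omega_P (Omega_b u v)" for u v
    by (auto simp: Omega_c_def Omega_P_def Omega_b_def vec_eq_iff algebra_simps)
  show "2 * (Omega_C u v \<bullet> w) = Omega_c u v \<bullet> w + v \<bullet> Omega_c u w + Omega_c v u \<bullet> w + u \<bullet> Omega_c v w - Omega_c w u \<bullet> v - u \<bullet> Omega_c w v" for u v w
    unfolding inner_8 by (simp add: Omega_c_def Omega_C_def algebra_simps)
qed (auto simp: Omega_b_def Omega_P_def Omega_Q_def vec_eq_iff linear_iff algebra_simps)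

lemma Omega_alt: "Omega0 \<in> alt_forms 4"
  unfolding Omega0_eq_lform by (rule lform_alt_forms) (auto simp: Omega_list_def)

text \<open>\<open>om\<close> in direction e1 is the skew part of N. The coefficient of e1348
  receives 6 from the term -6 e1234 and 2 from the term 2 e1458, so nothing cancels.\<close>

lemma Omega_torsion: "dersum (nil_Omega.om (axis 1 1)) Omega0 (map basis_vec [1,3,4,8]) \<noteq> 0"
proof -
  let ?R = "\<lambda>i::8. if i = 2 then [(sqrt 3, 3), (-1, 8)] else if i = 3 then [(- sqrt 3, 2), (1, 5)]
    else if i = 5 then [(-1, 3), (- sqrt 3, 8)] else if i = 8 then [(1, 2), (sqrt 3, 5)] else [] :: (real \<times> 8) list"
  have "nil_Omega.om (axis 1 1) v $ i = (\<Sum>(a, p)\<leftarrow>?R i. a * v $ p)" for v i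
    by (auto simp: nil_Omega.om_def Omega_c_def Omega_C_def axis_def)
  then have e: "dersum (nil_Omega.om (axis 1 1)) Omega0 (map basis_vec [1,3,4,8])
     = lform (concat (map (\<lambda>(a, I). map (\<lambda>(b, M). (a * b, M)) (alist ?R I)) Omega_list)) (map basis_vec [1,3,4,8])"
    unfolding Omega0_eq_lform by (rule dersum_lform) (auto simp: Omega_list_def)
  have "ecov J [axis 1 1, axis 3 1, axis 4 1, axis 8 1] = lform (contrs [1,3,4,8] J) []" if "length J = 4" for J
    using ecov_axes[of J "[1,3,4,8]" "[]"] that by simp
  then show ?thesis unfolding e by (simp add: Omega_list_def)
qed

text \<open>The direction e4 is a flat factor; in direction e1 the Ricci curvature is minus the
  squared norm of the symmetric part of N.\<close>

lemma not_einstein_Omega: "\<not> einstein nil_Omega.atlas nil_Omega.g"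
proof
  assume "einstein nil_Omega.atlas nil_Omega.g"
  then obtain \<kappa> where k: "\<And>v w. (\<Sum>i\<in>UNIV. nil_Omega.Rm (axis i 1) v w $ i) = \<kappa> * (v \<bullet> w)"
    using nil_Omega.einstein_ricci by blast
  have "(\<Sum>i\<in>UNIV. nil_Omega.Rm (axis i 1) (axis 4 1) (axis 4 1) $ i) = 0"
    by (simp add: sum_8 nil_Omega.Rm_def Omega_c_def Omega_C_def axis_def)
  moreover have "(\<Sum>i\<in>UNIV. nil_Omega.Rm (axis i 1) (axis 1 1) (axis 1 1) $ i) \<noteq> 0"
    by (simp add: sum_8 nil_Omega.Rm_def Omega_c_def Omega_C_def axis_def)
  ultimately show False unfolding k by (simp add: inner_axis)
qed

lemma harmonic_Sp1Sp2_nilmanifold: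
  "manifold8 nil_Omega.quot nil_Omega.atlas \<and> compact_space nil_Omega.quot \<and>
    harmonic_Sp1Sp2_structure nil_Omega.atlas (nil_Omega.fld Omega0) nil_Omega.g \<and>
    nonvanishing_torsion nil_Omega.atlas nil_Omega.g 4 (nil_Omega.fld Omega0) \<and> \<not> einstein nil_Omega.atlas nil_Omega.g"
proof -
  have m: "multilinear_on 4 Omega0" using Omega_alt by (simp add: alt_forms_def)
  have "harmonic nil_Omega.atlas nil_Omega.g 4 (nil_Omega.fld Omega0)"
    by (rule nil_Omega.harmonic_fld[OF m]) (simp_all add: dext_Omega dext_star_Omega)
  moreover have "nonvanishing_torsion nil_Omega.atlas nil_Omega.g 4 (nil_Omega.fld Omega0)"
    by (rule nil_Omega.nonvanishing_fld[OF m _ Omega_torsion]) simp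
  ultimately show ?thesis
    using nil_Omega.manifold_quot nil_Omega.compact_quot nil_Omega.Sp1Sp2_fld[OF Omega_alt] not_einstein_Omega
    by (simp add: harmonic_Sp1Sp2_structure_def)
qed

theorem theorem35:
  shows
    "(\<exists>(X :: point topology) A \<rho> g.
        manifold8 X A \<and> compact_space X \<and>
        harmonic_PSU3_structure A \<rho> g \<and> nonvanishing_torsion A g 3 \<rho>) \<and>
     (\<exists>(X :: point topology) A \<Omega> g.
        manifold8 X A \<and> compact_space X \<and>
        harmonic_Sp1Sp2_structure A \<Omega> g \<and> nonvanishing_torsion A g 4 \<Omega>) \<and>
     (\<exists>(X :: point topology) A \<rho> g.
        manifold8 X A \<and> compact_space X \<and>
        harmonic_PSU3_structure A \<rho> g \<and> nonvanishing_torsion A g 3 \<rho> \<and>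
        \<not> einstein A g) \<and>
     (\<exists>(X :: point topology) A \<Omega> g.
        manifold8 X A \<and> compact_space X \<and>
        harmonic_Sp1Sp2_structure A \<Omega> g \<and> nonvanishing_torsion A g 4 \<Omega> \<and>
        \<not> einstein A g)"
  \<comment> \<open>The non-Einstein examples also witness the first two existence claims.\<close>
  using harmonic_PSU3_nilmanifold harmonic_Sp1Sp2_nilmanifold by blast

end
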